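(* There exists a post-quantum sparse pseudorandom distribution, i.e., an ensemble $\{D_\lambda\}_{\lambda\in\mathbb{N}}$, where each $D_\lambda$ is a probability distribution on $\{0,1\}^\lambda$, such that: (Sparseness) $|\mathsf{supp}(D_\lambda)|/2^\lambda = \mathsf{negl}(\lambda)$; and (Non-uniform post-quantum pseudorandomness) for every non-uniform QPT distinguisher $\{\mathcal{A}_\lambda,\rho_\lambda\}_{\lambda\in\mathbb{N}}$, $$\left|\Pr_{y\gets D_\lambda}[\mathcal{A}_\lambda(\rho_\lambda,y)=1]-\Pr_{y'\gets\{0,1\}^\lambda}[\mathcal{A}_\lambda(\rho_\lambda,y')=1]\right|=\mathsf{negl}(\lambda).$$
   Context: A non-uniform QPT algorithm $\{\mathcal{A}_\lambda,\rho_\lambda\}_{\lambda\in\mathbb{N}}$ consists, for each $\lambda$, of a quantum circuit $\mathcal{A}_\lambda$ of size $\mathrm{poly}(\lambda)$ and a quantum advice state $\rho_\lambda$ on $\mathrm{poly}(\lambda)$ qubits (arbitrary, not necessarily efficiently preparable). The distributions $D_\lambda$ are not required to be efficiently samplable. $\mathsf{negl}$ denotes a negligible function. *)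

theory Defs
  imports "HOL-Probability.Probability" "Jordan_Normal_Form.Schur_Decomposition"
begin

definition negligible :: "(nat \<Rightarrow> real) \<Rightarrow> bool" where
  "negligible f \<longleftrightarrow> (\<forall>c::nat. \<exists>N. \<forall>n\<ge>N. \<bar>f n\<bar> < 1 / real n ^ c)"

text \<open>Qubit i of an n-qubit computational basis index x (0 <= x < 2^n) is bit i of x.\<close>

definition qbit :: "nat \<Rightarrow> nat \<Rightarrow> nat" where
  "qbit x i = x div 2 ^ i mod 2"

datatype gate = Had nat | Tgate nat | CNOT nat nat  (* CNOT control target *)

definition had_entry :: "nat \<Rightarrow> nat \<Rightarrow> complex" where
  "had_entry a b = (if a = 1 \<and> b = 1 then - 1 else 1) / complex_of_real (sqrt 2)"

definition t_entry :: "nat \<Rightarrow> nat \<Rightarrow> complex" where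
  "t_entry a b = (if a \<noteq> b then 0 else if a = 1 then cis (pi / 4) else 1)"

definition gate_mat :: "nat \<Rightarrow> gate \<Rightarrow> complex mat" where
  "gate_mat n g = mat (2 ^ n) (2 ^ n) (\<lambda>(x, y).
     (case g of
        Had i \<Rightarrow> if (\<forall>k<n. k \<noteq> i \<longrightarrow> qbit x k = qbit y k)
                 then had_entry (qbit x i) (qbit y i) else 0
      | Tgate i \<Rightarrow> if (\<forall>k<n. k \<noteq> i \<longrightarrow> qbit x k = qbit y k)
                 then t_entry (qbit x i) (qbit y i) else 0
      | CNOT c t \<Rightarrow> if (\<forall>k<n. k \<noteq> t \<longrightarrow> qbit x k = qbit y k)
                      \<and> qbit x t = (qbit y t + qbit y c) mod 2 then 1 else 0))"

definition wf_gate :: "nat \<Rightarrow> gate \<Rightarrow> bool" where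
  "wf_gate n g = (case g of Had i \<Rightarrow> i < n | Tgate i \<Rightarrow> i < n
                   | CNOT c t \<Rightarrow> c < n \<and> t < n \<and> c \<noteq> t)"

definition circuit_unitary :: "nat \<Rightarrow> gate list \<Rightarrow> complex mat" where
  "circuit_unitary n gs = foldl (\<lambda>U g. gate_mat n g * U) (1\<^sub>m (2 ^ n)) gs"

definition mtrace :: "complex mat \<Rightarrow> complex" where
  "mtrace A = (\<Sum>i<dim_row A. A $$ (i, i))"

definition density_mat :: "nat \<Rightarrow> complex mat \<Rightarrow> bool" where
  "density_mat d \<rho> \<longleftrightarrow> \<rho> \<in> carrier_mat d d \<and> mtrace \<rho> = 1 \<and>
     (\<forall>v \<in> carrier_vec d.
        let q = (\<Sum>i<d. \<Sum>j<d. cnj (v $ i) * \<rho> $$ (i, j) * v $ j) in Im q = 0 \<and> Re q \<ge> 0)"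

definition enc :: "bool list \<Rightarrow> nat" where
  "enc y = (\<Sum>i<length y. if y ! i then 2 ^ i else 0)"

text \<open>Initial state on n wires: wires 0..lam-1 hold the input y, wires lam..lam+m-1 hold the
  advice state rho (m qubits), all remaining wires are ancillas in state |0>.\<close>

definition init_state :: "nat \<Rightarrow> nat \<Rightarrow> nat \<Rightarrow> complex mat \<Rightarrow> bool list \<Rightarrow> complex mat" where
  "init_state lam m n \<rho> y = mat (2 ^ n) (2 ^ n) (\<lambda>(x, x').
     if x mod 2 ^ lam = enc y \<and> x' mod 2 ^ lam = enc y
        \<and> x div 2 ^ (lam + m) = 0 \<and> x' div 2 ^ (lam + m) = 0
     then \<rho> $$ (x div 2 ^ lam mod 2 ^ m, x' div 2 ^ lam mod 2 ^ m) else 0)"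

definition proj_out1 :: "nat \<Rightarrow> complex mat" where
  "proj_out1 n = mat (2 ^ n) (2 ^ n) (\<lambda>(x, x'). if x = x' \<and> qbit x 0 = 1 then 1 else 0)"

definition accept_prob ::
  "nat \<Rightarrow> nat \<Rightarrow> nat \<Rightarrow> gate list \<Rightarrow> complex mat \<Rightarrow> bool list \<Rightarrow> real" where
  "accept_prob lam m n gs \<rho> y =
     (let U = circuit_unitary n gs in
      Re (mtrace (proj_out1 n * (U * init_state lam m n \<rho> y * mat_adjoint U))))"

definition nonuniform_qpt ::
  "(nat \<Rightarrow> nat) \<Rightarrow> (nat \<Rightarrow> nat) \<Rightarrow> (nat \<Rightarrow> gate list) \<Rightarrow> (nat \<Rightarrow> complex mat) \<Rightarrow> bool" where
  "nonuniform_qpt nwires madv gs \<rho> \<longleftrightarrow>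
     (\<exists>c::nat. \<forall>lam. 0 < nwires lam \<and> lam + madv lam \<le> nwires lam
        \<and> (\<forall>g \<in> set (gs lam). wf_gate (nwires lam) g)
        \<and> density_mat (2 ^ madv lam) (\<rho> lam)
        \<and> nwires lam + length (gs lam) \<le> c * lam ^ c + c)"

definition uniform_bits :: "nat \<Rightarrow> bool list pmf" where
  "uniform_bits lam = pmf_of_set {y. length y = lam}"

end

theory Submission
  imports Defs "HOL-Library.Function_Algebras" "HOL-Real_Asymp.Real_Asymp"
begin

text \<open>The distribution \<open>D\<close> is the empirical distribution of \<open>K\<close> well-chosen strings. For a fixed circuit, the
  acceptance probability on input \<open>y\<close> with advice \<open>\<rho>\<close> is \<open>Tr (\<rho> M\<^sub>y)\<close> with \<open>0 \<le> M\<^sub>y \<le> 1\<close>, so a sample fools the circuit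
  with every advice state simultaneously once the average of the centred operators
  \<open>X\<^sub>y = M\<^sub>y - avg M\<close> over the sample has small operator norm.

  This matrix concentration is obtained from the trace moment \<open>E Tr ((\<Sum>\<^sub>k X\<^bsub>f k\<^esub>) ^ (2 p))\<close> over independent
  uniform samples \<open>f\<close>. Expanding it into words, every word in which some letter occurs exactly once
  averages to zero. The remaining words number at most \<open>K ^ p * p ^ (2 p)\<close>, and each has diagonal entries at most
  \<open>2 ^ (2 p)\<close>. Conversely \<open>Tr (\<rho> T) ^ (2 p) \<le> Tr (T ^ (2 p))\<close> for self-adjoint \<open>T\<close> when \<open>p\<close> is a power of
  two, by iterating \<open>Tr (\<rho> T)\<^sup>2 \<le> Tr (\<rho> T\<^sup>2)\<close>.

  Circuits of size at most \<open>s = 2 ^ (\<lambda> div 32)\<close>, weighted by their advice dimensions, number at most \<open>2 ^ p\<close>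
  for \<open>p = 8 s\<^sup>2\<close>. Hence for \<open>K = p ^ 4\<close> one sample is good for all of them, with advantage at most \<open>3 / p\<close>.\<close>

section \<open>Moments of sums of independent centred operators\<close>

lemma sum_fun_apply: "(\<Sum>a\<in>A. f a) x = (\<Sum>a\<in>A. f a x)"
  by (induction A rule: infinite_finite_induct) simp_all

lemma additive_foldr:
  fixes X :: "'k \<Rightarrow> 'v::ab_group_add \<Rightarrow> 'v"
  assumes "\<And>k. k \<in> set w \<Longrightarrow> Modules.additive (X k)"
  shows "Modules.additive (foldr X w)"
  using assms by (induction w) (auto simp: Modules.additive_def)

text \<open>Noncommutative multinomial expansion, with composition as the product and
  \<open>foldr X w\<close> as the product along the word \<open>w\<close>. Only additivity is used,
  so the operators stay plain functions on an abelian group.\<close>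

lemma funpow_sum_eq_sum_words:
  fixes X :: "'k \<Rightarrow> 'v::ab_group_add \<Rightarrow> 'v"
  assumes fin: "finite S" and add: "\<And>k. k \<in> S \<Longrightarrow> Modules.additive (X k)"
  shows "((\<lambda>v. \<Sum>k\<in>S. X k v) ^^ q) v = (\<Sum>w | set w \<subseteq> S \<and> length w = q. foldr X w v)"
proof (induction q)
  case 0
  have "{w::'k list. set w \<subseteq> S \<and> length w = 0} = {[]}" by auto
  then show ?case by simp
next
  case (Suc q)
  let ?W = "{w. set w \<subseteq> S \<and> length w = q}"
  have "((\<lambda>v. \<Sum>k\<in>S. X k v) ^^ Suc q) v = (\<Sum>k\<in>S. X k (\<Sum>w\<in>?W. foldr X w v))"
    using Suc by simp
  also have "\<dots> = (\<Sum>k\<in>S. \<Sum>w\<in>?W. X k (foldr X w v))"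
    by (intro sum.cong refl Modules.additive.sum add)
  also have "\<dots> = (\<Sum>w\<in>?W. \<Sum>k\<in>S. X k (foldr X w v))"
    by (rule sum.swap)
  also have "\<dots> = (\<Sum>(w, k)\<in>?W \<times> S. foldr X (k # w) v)"
    by (simp add: sum.cartesian_product)
  also have "\<dots> = (\<Sum>w\<in>(\<lambda>(w, k). k # w) ` (?W \<times> S). foldr X w v)"
    by (subst sum.reindex) (auto simp: inj_on_def case_prod_beta)
  also have "(\<lambda>(w, k). k # w) ` (?W \<times> S) = {w. set w \<subseteq> S \<and> length w = Suc q}"
    by (simp add: lists_length_Suc_eq)
  finally show ?case .
qed

text \<open>Finite Fubini for samples: coordinate \<open>k\<close> is averaged while all the others
  stay fixed.\<close>

lemma sum_PiE_insert:
  assumes "k \<notin> T"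
  shows "(\<Sum>f\<in>Pi\<^sub>E (insert k T) (\<lambda>_. Y). g f) = (\<Sum>f\<in>Pi\<^sub>E T (\<lambda>_. Y). \<Sum>y\<in>Y. g (f(k := y)))"
  unfolding PiE_insert_eq
  by (subst sum.reindex[OF inj_combinator[OF assms]], subst sum.swap)
     (simp add: sum.cartesian_product case_prod_beta)

text \<open>Fix all coordinates of the sample but \<open>k\<close>. Since \<open>k\<close> occurs
  once, the word is an additive map of \<open>X (f k)\<close> applied to a fixed vector, so summing
  over \<open>f k\<close> yields that map at the mean, which is zero.\<close>

lemma sum_word_eq_0:
  fixes X :: "'y \<Rightarrow> 'v::ab_group_add \<Rightarrow> 'v" and L :: "'v \<Rightarrow> 'r::ab_group_add"
  assumes add: "\<And>y. y \<in> Y \<Longrightarrow> Modules.additive (X y)"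
    and mean: "\<And>v. (\<Sum>y\<in>Y. X y v) = 0"
    and L: "Modules.additive L"
    and w: "set w \<subseteq> S" "count_list w k = 1"
  shows "(\<Sum>f\<in>Pi\<^sub>E S (\<lambda>_. Y). L (foldr (\<lambda>k. X (f k)) w e)) = 0"
proof -
  have "k \<in> set w" using w(2) by (metis count_notin zero_neq_one)
  then obtain u v where uv: "w = u @ k # v" by (meson split_list)
  with w(2) have "count_list u k = 0" "count_list v k = 0" by auto
  then have k: "k \<notin> set u" "k \<notin> set v" by (auto simp: count_list_0_iff)
  define T where "T = S - {k}"
  have S: "S = insert k T" "k \<notin> T" using \<open>k \<in> set w\<close> w(1) by (auto simp: T_def)
  have "(\<Sum>y\<in>Y. L (foldr (\<lambda>j. X ((f(k := y)) j)) w e)) = 0" if f: "f \<in> Pi\<^sub>E T (\<lambda>_. Y)" for f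
  proof -
    let ?U = "foldr (\<lambda>j. X (f j)) u" and ?v = "foldr (\<lambda>j. X (f j)) v e"
    have "Modules.additive ?U"
      using f w(1) k S unfolding uv by (intro additive_foldr add) (auto simp: PiE_iff)
    then have LU: "Modules.additive (\<lambda>x. L (?U x))"
      using L by (auto simp: Modules.additive_def)
    have "foldr (\<lambda>j. X ((f(k := y)) j)) w e = ?U (X y ?v)" for y
    proof -
      have "foldr (\<lambda>j. X ((f(k := y)) j)) v e = ?v"
        using k by (intro foldr_cong) auto
      moreover have "foldr (\<lambda>j. X ((f(k := y)) j)) u x = ?U x" for x
        using k by (intro foldr_cong) auto
      ultimately show ?thesis by (simp add: uv)
    qed
    then have "(\<Sum>y\<in>Y. L (foldr (\<lambda>j. X ((f(k := y)) j)) w e)) = (\<Sum>y\<in>Y. L (?U (X y ?v)))"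
      by simp
    also have "\<dots> = L (?U (\<Sum>y\<in>Y. X y ?v))"
      using Modules.additive.sum[OF LU, of "\<lambda>y. X y ?v" Y] by simp
    also have "\<dots> = 0"
      using mean Modules.additive.zero[OF LU] by simp
    finally show ?thesis .
  qed
  then show ?thesis
    unfolding S(1) by (subst sum_PiE_insert[OF S(2)]) simp
qed

section \<open>Counting words without singleton letters, and the resulting moment bound\<close>

lemma card_le_half_length:
  assumes "\<And>k. count_list w k \<noteq> 1" "length w = 2 * p"
  shows "card (set w) \<le> p"
proof -
  have "2 * card (set w) = (\<Sum>k\<in>set w. 2)" by simp
  also have "\<dots> \<le> (\<Sum>k\<in>set w. count_list w k)"
  proof (rule sum_mono)
    fix k assume "k \<in> set w"
    then have "count_list w k \<noteq> 0" by (simp add: count_list_0_iff)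
    with assms(1)[of k] show "2 \<le> count_list w k" by linarith
  qed
  also have "\<dots> = 2 * p" using assms(2) by (simp add: sum_count_set)
  finally show ?thesis by simp
qed

text \<open>Such a word has at most \<open>p\<close> distinct letters, so it factors through a word of length \<open>p\<close>.\<close>

lemma card_words_no_singleton:
  fixes S :: "'k set"
  assumes S: "finite S" and p: "p > 0"
  shows "card {w. set w \<subseteq> S \<and> length w = 2 * p \<and> (\<forall>k. count_list w k \<noteq> 1)}
           \<le> card S ^ p * p ^ (2 * p)"
proof -
  let ?G = "{g. set g \<subseteq> S \<and> length g = p}" and ?H = "{h. set h \<subseteq> {..<p} \<and> length h = 2 * p}"
  have sub: "{w. set w \<subseteq> S \<and> length w = 2 * p \<and> (\<forall>k. count_list w k \<noteq> 1)}
      \<subseteq> (\<lambda>(g, h). map ((!) g) h) ` (?G \<times> ?H)"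
  proof
    fix w assume "w \<in> {w. set w \<subseteq> S \<and> length w = 2 * p \<and> (\<forall>k. count_list w k \<noteq> 1)}"
    then have w: "set w \<subseteq> S" "length w = 2 * p" "\<And>k. count_list w k \<noteq> 1" by auto
    have "w \<noteq> []" using w(2) p by auto
    \<comment> \<open>The distinct letters of \<open>w\<close>, padded to length exactly
      \<open>p\<close>. Padding with \<open>hd w\<close> adds no new letter because \<open>w\<close>
      is nonempty.\<close>
    define g where "g = remdups w @ replicate (p - card (set w)) (hd w)"
    have "card (set w) \<le> p" using card_le_half_length w by blast
    then have g: "length g = p" "set g = set w"
      using \<open>w \<noteq> []\<close> by (auto simp: g_def length_remdups_card_conv)
    have "\<forall>x\<in>set w. \<exists>i<p. g ! i = x" using g by (metis in_set_conv_nth)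
    then obtain ix where ix: "\<And>x. x \<in> set w \<Longrightarrow> ix x < p \<and> g ! ix x = x" by metis
    have "w = map ((!) g) (map ix w)" using ix by (simp add: map_idI)
    moreover have "g \<in> ?G" "map ix w \<in> ?H" using g w ix by (fastforce+)
    ultimately show "w \<in> (\<lambda>(g, h). map ((!) g) h) ` (?G \<times> ?H)"
      by (metis (no_types, lifting) SigmaI case_prod_conv image_eqI)
  qed
  have fin: "finite (?G \<times> ?H)" using S by (simp add: finite_lists_length_eq)
  have "card {w. set w \<subseteq> S \<and> length w = 2 * p \<and> (\<forall>k. count_list w k \<noteq> 1)} \<le> card (?G \<times> ?H)"
    using surj_card_le[OF fin sub] .
  also have "\<dots> = card S ^ p * p ^ (2 * p)"
    using S by (simp add: card_cartesian_product card_lists_length_eq)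
  finally show ?thesis .
qed

text \<open>There are \<open>card Y ^ card S\<close> samples, so after division this bounds an
  expectation. The functional \<open>L\<close> and start vector \<open>e\<close> stay abstract here;
  a diagonal entry of the operator power is the intended instance.\<close>

lemma moment_bound:
  fixes X :: "'y \<Rightarrow> 'v::ab_group_add \<Rightarrow> 'v" and L :: "'v \<Rightarrow> real" and S :: "'k set" and B :: real
  assumes fin: "finite S" "finite Y" and p: "p > 0"
    and add: "\<And>y. y \<in> Y \<Longrightarrow> Modules.additive (X y)"
    and mean: "\<And>v. (\<Sum>y\<in>Y. X y v) = 0"
    and L: "Modules.additive L"
    and bound: "\<And>ys. set ys \<subseteq> Y \<Longrightarrow> length ys = 2 * p \<Longrightarrow> L (foldr X ys e) \<le> B"
    and B: "B \<ge> 0"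
  shows "(\<Sum>f\<in>Pi\<^sub>E S (\<lambda>_. Y). L (((\<lambda>v. \<Sum>k\<in>S. X (f k) v) ^^ (2 * p)) e))
           \<le> real (card Y ^ card S) * (real (card S ^ p * p ^ (2 * p)) * B)"
proof -
  let ?W = "{w. set w \<subseteq> S \<and> length w = 2 * p}"
  let ?W2 = "{w. set w \<subseteq> S \<and> length w = 2 * p \<and> (\<forall>k. count_list w k \<noteq> 1)}"
  let ?F = "Pi\<^sub>E S (\<lambda>_. Y)"
  have finW: "finite ?W" using fin by (simp add: finite_lists_length_eq)
  have "(\<Sum>f\<in>?F. L (((\<lambda>v. \<Sum>k\<in>S. X (f k) v) ^^ (2 * p)) e))
      = (\<Sum>f\<in>?F. \<Sum>w\<in>?W. L (foldr (\<lambda>k. X (f k)) w e))"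
  proof (rule sum.cong[OF refl])
    fix f assume "f \<in> ?F"
    then have "\<And>k. k \<in> S \<Longrightarrow> Modules.additive (X (f k))" by (auto intro!: add)
    then show "L (((\<lambda>v. \<Sum>k\<in>S. X (f k) v) ^^ (2 * p)) e) = (\<Sum>w\<in>?W. L (foldr (\<lambda>k. X (f k)) w e))"
      by (subst funpow_sum_eq_sum_words[OF fin(1)]) (auto simp: Modules.additive.sum[OF L])
  qed
  also have "\<dots> = (\<Sum>w\<in>?W. \<Sum>f\<in>?F. L (foldr (\<lambda>k. X (f k)) w e))"
    by (rule sum.swap)
  \<comment> \<open>Independence and centring enter only here: a word outside \<open>?W2\<close> has
    a singleton letter, so its sum over all samples vanishes.\<close>
  also have "\<dots> = (\<Sum>w\<in>?W2. \<Sum>f\<in>?F. L (foldr (\<lambda>k. X (f k)) w e))"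
    by (rule sum.mono_neutral_right[OF finW]) (auto intro!: sum_word_eq_0[OF add mean L])
  also have "\<dots> \<le> (\<Sum>w\<in>?W2. \<Sum>f\<in>?F. B)"
  proof (intro sum_mono)
    fix w f assume w: "w \<in> ?W2" and f: "f \<in> ?F"
    have "foldr (\<lambda>k. X (f k)) w e = foldr X (map f w) e" by (simp add: foldr_map comp_def)
    then show "L (foldr (\<lambda>k. X (f k)) w e) \<le> B" using bound[of "map f w"] w f by auto
  qed
  also have "\<dots> = real (card ?W2) * (real (card Y ^ card S) * B)"
    using fin by (simp add: card_PiE)
  also have "\<dots> \<le> real (card S ^ p * p ^ (2 * p)) * (real (card Y ^ card S) * B)"
    using card_words_no_singleton[OF fin(1) p] B by (intro mult_right_mono of_nat_mono mult_nonneg_nonneg) simp_all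
  finally show ?thesis by (simp add: mult_ac)
qed

section \<open>States and self-adjoint operators\<close>

text \<open>Vectors of dimension \<open>d\<close> are total functions read only below
  \<open>d\<close>. Pointwise addition makes them an abelian group, as the moment bound requires,
  and operators of different dimensions share one type.\<close>

definition ip :: "nat \<Rightarrow> (nat \<Rightarrow> complex) \<Rightarrow> (nat \<Rightarrow> complex) \<Rightarrow> complex" where
  "ip d u v = (\<Sum>i<d. cnj (u i) * v i)"

definition basis_vec :: "nat \<Rightarrow> nat \<Rightarrow> complex" where
  "basis_vec i = (\<lambda>j. if j = i then 1 else 0)"

definition psd_trace_one :: "nat \<Rightarrow> (nat \<Rightarrow> nat \<Rightarrow> complex) \<Rightarrow> bool" where
  "psd_trace_one d \<rho> \<longleftrightarrow> (\<Sum>i<d. \<rho> i i) = 1 \<and>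
     (\<forall>v. 0 \<le> Re (\<Sum>i<d. \<Sum>j<d. cnj (v i) * \<rho> i j * v j))"

text \<open>This is \<open>Tr (\<rho> T)\<close>: \<open>T (basis_vec i) j\<close> is the matrix
  entry of \<open>T\<close> in row \<open>j\<close> and column \<open>i\<close>.\<close>

definition expval ::
    "nat \<Rightarrow> (nat \<Rightarrow> nat \<Rightarrow> complex) \<Rightarrow> ((nat \<Rightarrow> complex) \<Rightarrow> nat \<Rightarrow> complex) \<Rightarrow> real" where
  "expval d \<rho> T = Re (\<Sum>i<d. \<Sum>j<d. \<rho> i j * T (basis_vec i) j)"

definition op_trace :: "nat \<Rightarrow> ((nat \<Rightarrow> complex) \<Rightarrow> nat \<Rightarrow> complex) \<Rightarrow> real" where
  "op_trace d T = (\<Sum>i<d. Re (T (basis_vec i) i))"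

definition self_adjoint :: "nat \<Rightarrow> ((nat \<Rightarrow> complex) \<Rightarrow> nat \<Rightarrow> complex) \<Rightarrow> bool" where
  "self_adjoint d T \<longleftrightarrow> (\<forall>u v. ip d (T u) v = ip d u (T v))"

lemma ip_basis_vec: "j < d \<Longrightarrow> ip d (basis_vec j) v = v j"
  by (simp add: ip_def basis_vec_def if_distrib if_distribR cong: if_cong)

lemma ip_self: "ip d v v = of_real (\<Sum>i<d. (cmod (v i))\<^sup>2)"
  unfolding ip_def of_real_sum
  by (intro sum.cong refl) (simp add: complex_norm_square mult.commute del: of_real_power)

lemma self_adjoint_funpow:
  assumes "self_adjoint d T"
  shows "self_adjoint d (T ^^ n)"
proof (induction n)
  case (Suc n)
  then show ?case using assms by (auto simp: self_adjoint_def funpow_swap1)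
qed (simp add: self_adjoint_def)

text \<open>Pairing \<open>\<rho>\<close> with a Gram matrix splits into one quadratic form per
  coordinate \<open>k\<close>, at the vector \<open>\<lambda>i. cnj (w i k)\<close>. The double
  conjugate is kept so that each summand literally has the shape used in
  \<open>psd_trace_one\<close>.\<close>

lemma gram_eq_sum_forms:
  "(\<Sum>i<d. \<Sum>j<d. \<rho> i j * ip d' (w j) (w i))
     = (\<Sum>k<d'. \<Sum>i<d. \<Sum>j<d. cnj (cnj (w i k)) * \<rho> i j * cnj (w j k))"
proof -
  have "(\<Sum>i<d. \<Sum>j<d. \<rho> i j * ip d' (w j) (w i))
      = (\<Sum>i<d. \<Sum>j<d. \<Sum>k<d'. cnj (cnj (w i k)) * \<rho> i j * cnj (w j k))"
    by (simp add: ip_def sum_distrib_left mult_ac)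
  also have "\<dots> = (\<Sum>i<d. \<Sum>k<d'. \<Sum>j<d. cnj (cnj (w i k)) * \<rho> i j * cnj (w j k))"
    by (intro sum.cong refl sum.swap)
  also have "\<dots> = (\<Sum>k<d'. \<Sum>i<d. \<Sum>j<d. cnj (cnj (w i k)) * \<rho> i j * cnj (w j k))"
    by (rule sum.swap)
  finally show ?thesis .
qed

lemma gram_nonneg:
  assumes "psd_trace_one d \<rho>"
  shows "0 \<le> Re (\<Sum>i<d. \<Sum>j<d. \<rho> i j * ip d' (w j) (w i))"
  unfolding gram_eq_sum_forms Re_sum
  by (rule sum_nonneg) (use assms in \<open>simp only: psd_trace_one_def Re_sum[symmetric]\<close>)

text \<open>Nonnegativity of the variance: expand \<open>Tr (\<rho> (T - t)\<^sup>2) \<ge> 0\<close> at \<open>t = Tr (\<rho> T)\<close>.\<close>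

lemma expval_square_le:
  assumes \<rho>: "psd_trace_one d \<rho>" and T: "self_adjoint d T"
  shows "(expval d \<rho> T)\<^sup>2 \<le> expval d \<rho> (T \<circ> T)"
proof -
  define t where "t = expval d \<rho> T"
  \<comment> \<open>Column \<open>i\<close> of \<open>T - t\<close>; as \<open>T\<close> is
    self-adjoint and \<open>t\<close> is real, the Gram matrix of these columns is the square of
    \<open>T - t\<close>.\<close>
  define w where "w i = (\<lambda>k. T (basis_vec i) k - of_real t * basis_vec i k)" for i
  have ipw: "ip d (w j) (w i) = T (T (basis_vec i)) j - 2 * of_real t * T (basis_vec i) j
      + of_real (t\<^sup>2) * basis_vec i j" if "i < d" "j < d" for i j
  proof -
    have "ip d (w j) (w i) = ip d (T (basis_vec j)) (T (basis_vec i))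
        - of_real t * ip d (T (basis_vec j)) (basis_vec i)
        - of_real t * ip d (basis_vec j) (T (basis_vec i))
        + of_real (t\<^sup>2) * ip d (basis_vec j) (basis_vec i)"
      unfolding ip_def w_def sum_distrib_left sum_subtractf[symmetric] sum.distrib[symmetric]
      by (intro sum.cong refl) (simp add: algebra_simps power2_eq_square)
    also have "ip d (T (basis_vec j)) (T (basis_vec i)) = T (T (basis_vec i)) j"
      using T that by (simp add: self_adjoint_def ip_basis_vec)
    also have "ip d (T (basis_vec j)) (basis_vec i) = T (basis_vec i) j"
      using T that by (simp add: self_adjoint_def ip_basis_vec)
    also have "ip d (basis_vec j) (T (basis_vec i)) = T (basis_vec i) j"
      using that by (simp add: ip_basis_vec)
    also have "ip d (basis_vec j) (basis_vec i) = basis_vec i j"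
      using that by (simp add: ip_basis_vec)
    finally show ?thesis by simp
  qed
  have "(\<Sum>i<d. \<Sum>j<d. \<rho> i j * ip d (w j) (w i))
      = (\<Sum>i<d. \<Sum>j<d. \<rho> i j * T (T (basis_vec i)) j) - 2 * of_real t * (\<Sum>i<d. \<Sum>j<d. \<rho> i j * T (basis_vec i) j)
        + of_real (t\<^sup>2) * (\<Sum>i<d. \<Sum>j<d. \<rho> i j * basis_vec i j)"
    unfolding sum_distrib_left sum_subtractf[symmetric] sum.distrib[symmetric]
    by (intro sum.cong refl) (simp add: ipw algebra_simps)
  also have "(\<Sum>i<d. \<Sum>j<d. \<rho> i j * basis_vec i j) = (\<Sum>i<d. \<rho> i i)"
    by (simp add: basis_vec_def if_distrib cong: if_cong)
  also have "\<dots> = 1" using \<rho> by (simp add: psd_trace_one_def)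
  finally have "Re (\<Sum>i<d. \<Sum>j<d. \<rho> i j * ip d (w j) (w i)) = expval d \<rho> (T \<circ> T) - 2 * t * t + t\<^sup>2"
    by (simp add: expval_def t_def del: Re_sum)
  with gram_nonneg[OF \<rho>, of d w] show ?thesis
    by (simp add: power2_eq_square t_def)
qed

text \<open>Each pair of indices contributes via the form at a vector supported on \<open>{i, j}\<close>, so no
  spectral decomposition of \<open>\<rho>\<close> is needed.\<close>

lemma psd_form_le:
  assumes \<rho>: "psd_trace_one d \<rho>"
  shows "Re (\<Sum>i<d. \<Sum>j<d. cnj (v i) * \<rho> i j * v j) \<le> (\<Sum>i<d. (cmod (v i))\<^sup>2)"
proof -
  let ?b = "\<lambda>i j. cnj (v i) * \<rho> i j * v j"
  let ?S = "\<Sum>i<d. (cmod (v i))\<^sup>2"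
  have two: "Re (?b i j) + Re (?b j i) \<le> Re (\<rho> i i) * (cmod (v j))\<^sup>2 + Re (\<rho> j j) * (cmod (v i))\<^sup>2"
    if "i < d" "j < d" for i j
  proof (cases "i = j")
    case True
    have "Re (?b i i) = Re (\<rho> i i) * (cmod (v i))\<^sup>2"
      unfolding cmod_power2 by (simp add: algebra_simps power2_eq_square)
    with True show ?thesis by simp
  next
    case False
    \<comment> \<open>Chosen so that the form at \<open>u\<close> has exactly the two cross terms of
      the form at \<open>v\<close>, with negative sign, beside diagonal terms weighted by the
      opposite coordinates of \<open>v\<close>.\<close>
    define u where "u k = (if k = i then cnj (v j) else if k = j then - cnj (v i) else 0)" for k
    have "(\<Sum>k<d. \<Sum>l<d. cnj (u k) * \<rho> k l * u l) = (\<Sum>k\<in>{i, j}. \<Sum>l\<in>{i, j}. cnj (u k) * \<rho> k l * u l)"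
    proof -
      have inner: "(\<Sum>l<d. cnj (u k) * \<rho> k l * u l) = (\<Sum>l\<in>{i, j}. cnj (u k) * \<rho> k l * u l)" for k
        using that by (intro sum.mono_neutral_right) (auto simp: u_def)
      show ?thesis
        unfolding inner using that by (intro sum.mono_neutral_right) (auto simp: u_def)
    qed
    also have "\<dots> = v j * \<rho> i i * cnj (v j) - v j * \<rho> i j * cnj (v i)
         - v i * \<rho> j i * cnj (v j) + v i * \<rho> j j * cnj (v i)"
      using False by (simp add: u_def)
    also have "Re \<dots> = Re (\<rho> i i) * (cmod (v j))\<^sup>2 + Re (\<rho> j j) * (cmod (v i))\<^sup>2 - (Re (?b i j) + Re (?b j i))"
      unfolding cmod_power2 by (simp add: algebra_simps power2_eq_square)
    finally show ?thesis
      using spec[OF conjunct2[OF \<rho>[unfolded psd_trace_one_def]], of u] by linarith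
  qed
  have tr: "(\<Sum>i<d. Re (\<rho> i i)) = 1"
    using arg_cong[OF conjunct1[OF \<rho>[unfolded psd_trace_one_def]], of Re] by simp
  \<comment> \<open>The double sum is added to its transpose so that \<open>two\<close> applies to
    every pair; the right-hand sides then add up to twice the trace times \<open>?S\<close>.\<close>
  have "2 * Re (\<Sum>i<d. \<Sum>j<d. ?b i j) = (\<Sum>i<d. \<Sum>j<d. Re (?b i j)) + (\<Sum>i<d. \<Sum>j<d. Re (?b j i))"
    unfolding sum.swap[of "\<lambda>i j. Re (?b j i)"] by (simp only: Re_sum mult_2)
  also have "\<dots> = (\<Sum>i<d. \<Sum>j<d. Re (?b i j) + Re (?b j i))"
    by (simp add: sum.distrib)
  also have "\<dots> \<le> (\<Sum>i<d. \<Sum>j<d. Re (\<rho> i i) * (cmod (v j))\<^sup>2 + Re (\<rho> j j) * (cmod (v i))\<^sup>2)"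
    by (intro sum_mono two) auto
  also have "\<dots> = (\<Sum>i<d. Re (\<rho> i i)) * ?S + (\<Sum>i<d. Re (\<rho> i i)) * ?S"
  proof -
    have "(\<Sum>i<d. \<Sum>j<d. Re (\<rho> j j) * (cmod (v i))\<^sup>2) = (\<Sum>i<d. Re (\<rho> i i)) * ?S"
      unfolding sum_product by (rule sum.swap)
    moreover have "(\<Sum>i<d. \<Sum>j<d. Re (\<rho> i i) * (cmod (v j))\<^sup>2) = (\<Sum>i<d. Re (\<rho> i i)) * ?S"
      by (simp add: sum_product)
    ultimately show ?thesis by (simp only: sum.distrib)
  qed
  finally show ?thesis using tr by simp
qed

text \<open>\<open>psd_form_le\<close> says that \<open>\<rho>\<close> is at most the identity as a
  form. Applied to the conjugated rows of \<open>T\<close>, it leaves the sum of the squared row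
  norms, which is \<open>Tr (T^2)\<close>.\<close>

lemma expval_square_le_trace:
  assumes \<rho>: "psd_trace_one d \<rho>" and T: "self_adjoint d T"
  shows "expval d \<rho> (T \<circ> T) \<le> op_trace d (T \<circ> T)"
proof -
  let ?w = "\<lambda>i. T (basis_vec i)"
  have ip: "ip d (?w j) (?w i) = T (T (basis_vec i)) j" if "j < d" for i j
    using T that by (simp add: self_adjoint_def ip_basis_vec)
  have "(\<Sum>i<d. \<Sum>j<d. \<rho> i j * T (T (basis_vec i)) j) = (\<Sum>i<d. \<Sum>j<d. \<rho> i j * ip d (?w j) (?w i))"
    by (simp add: ip)
  also have "\<dots> = (\<Sum>k<d. \<Sum>i<d. \<Sum>j<d. cnj (cnj (?w i k)) * \<rho> i j * cnj (?w j k))"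
    by (rule gram_eq_sum_forms)
  finally have "expval d \<rho> (T \<circ> T) = (\<Sum>k<d. Re (\<Sum>i<d. \<Sum>j<d. cnj (cnj (?w i k)) * \<rho> i j * cnj (?w j k)))"
    by (simp add: expval_def del: complex_cnj_cnj)
  also have "\<dots> \<le> (\<Sum>k<d. \<Sum>i<d. (cmod (cnj (?w i k)))\<^sup>2)"
    by (intro sum_mono psd_form_le \<rho>)
  also have "\<dots> = (\<Sum>i<d. \<Sum>k<d. (cmod (?w i k))\<^sup>2)"
    by (subst sum.swap) simp
  also have "\<dots> = (\<Sum>i<d. Re (ip d (?w i) (?w i)))"
    by (simp add: ip_self)
  also have "\<dots> = op_trace d (T \<circ> T)"
    by (simp add: op_trace_def ip)
  finally show ?thesis .
qed

text \<open>Each induction step trades a square outside for one inside, replacing \<open>T\<close>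
  by \<open>T \<circ> T\<close>; hence \<open>T\<close> is generalised and the exponents are powers
  of two. Only the base case discards \<open>\<rho>\<close>.\<close>

lemma expval_power_le_trace:
  assumes \<rho>: "psd_trace_one d \<rho>" and T: "self_adjoint d T"
  shows "expval d \<rho> T ^ (2 ^ Suc r) \<le> op_trace d (T ^^ (2 ^ Suc r))"
  using T
proof (induction r arbitrary: T)
  case 0
  then show ?case
    using expval_square_le[OF \<rho> 0] expval_square_le_trace[OF \<rho> 0]
    by (simp add: numeral_2_eq_2 comp_def)
next
  case (Suc r)
  have "expval d \<rho> T ^ (2 ^ Suc (Suc r)) = ((expval d \<rho> T)\<^sup>2) ^ (2 ^ Suc r)"
    by (simp only: power_mult[symmetric] power_Suc)
  also have "\<dots> \<le> expval d \<rho> (T \<circ> T) ^ (2 ^ Suc r)"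
    by (intro power_mono expval_square_le \<rho> Suc) simp
  also have "\<dots> \<le> op_trace d ((T \<circ> T) ^^ (2 ^ Suc r))"
    using Suc.prems by (intro Suc.IH) (simp add: self_adjoint_def)
  also have "(T \<circ> T) ^^ (2 ^ Suc r) = (T ^^ 2) ^^ (2 ^ Suc r)"
    by (simp only: numeral_2_eq_2 funpow.simps comp_id)
  also have "\<dots> = T ^^ (2 ^ Suc (Suc r))"
    by (simp only: funpow_mult power_Suc mult.commute)
  finally show ?case .
qed

text \<open>Each diagonal entry is the squared norm of \<open>(T ^^ p) (basis_vec i)\<close>.
  Nonnegativity later lets a sum of traces bound each of its terms.\<close>

lemma op_trace_even_power_nonneg:
  assumes T: "self_adjoint d T"
  shows "0 \<le> op_trace d (T ^^ (2 * p))"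
  unfolding op_trace_def
proof (rule sum_nonneg)
  fix i assume "i \<in> {..<d}"
  then have "(T ^^ (2 * p)) (basis_vec i) i = ip d (basis_vec i) ((T ^^ p) ((T ^^ p) (basis_vec i)))"
    by (simp add: ip_basis_vec mult_2 funpow_add)
  also have "\<dots> = ip d ((T ^^ p) (basis_vec i)) ((T ^^ p) (basis_vec i))"
    using self_adjoint_funpow[OF T, of p] by (simp add: self_adjoint_def)
  finally show "0 \<le> Re ((T ^^ (2 * p)) (basis_vec i) i)"
    by (simp add: ip_self sum_nonneg)
qed

section \<open>Sampling operators uniformly over all states\<close>

definition vnorm :: "nat \<Rightarrow> (nat \<Rightarrow> complex) \<Rightarrow> real" where
  "vnorm d v = L2_set (\<lambda>i. cmod (v i)) {..<d}"

definition op_bound :: "nat \<Rightarrow> real \<Rightarrow> ((nat \<Rightarrow> complex) \<Rightarrow> nat \<Rightarrow> complex) \<Rightarrow> bool" where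
  "op_bound d c T \<longleftrightarrow> (\<forall>v. vnorm d (T v) \<le> c * vnorm d v)"

lemma vnorm_nonneg: "0 \<le> vnorm d v"
  by (simp add: vnorm_def)

lemma norm_le_vnorm: "i < d \<Longrightarrow> cmod (v i) \<le> vnorm d v"
  unfolding vnorm_def by (rule member_le_L2_set) auto

lemma vnorm_basis_vec: "i < d \<Longrightarrow> vnorm d (basis_vec i) = 1"
  by (simp add: vnorm_def L2_set_def basis_vec_def if_distrib if_distribR cong: if_cong)

lemma vnorm_add: "vnorm d (u + v) \<le> vnorm d u + vnorm d v"
proof -
  have "vnorm d (u + v) \<le> L2_set (\<lambda>i. cmod (u i) + cmod (v i)) {..<d}"
    unfolding vnorm_def by (rule L2_set_mono) (auto intro: norm_triangle_ineq)
  also have "\<dots> \<le> vnorm d u + vnorm d v"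
    unfolding vnorm_def by (rule L2_set_triangle_ineq)
  finally show ?thesis .
qed

lemma vnorm_scale: "vnorm d (\<lambda>i. c * v i) = cmod c * vnorm d v"
  unfolding vnorm_def norm_mult by (rule L2_set_right_distrib[symmetric]) simp

lemma vnorm_sum: "vnorm d (\<Sum>a\<in>A. f a) \<le> (\<Sum>a\<in>A. vnorm d (f a))"
proof (induction A rule: infinite_finite_induct)
  case (insert a A)
  then show ?case using vnorm_add[of d "f a" "sum f A"]
    by (simp only: sum.insert not_False_eq_True)
qed (simp_all add: vnorm_def L2_set_def)

lemma op_bound_foldr:
  assumes "\<And>y. y \<in> set ys \<Longrightarrow> op_bound d c (X y)" and "c \<ge> 0"
  shows "op_bound d (c ^ length ys) (foldr X ys)"
  using assms(1)
proof (induction ys)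
  case (Cons y ys)
  show ?case unfolding op_bound_def
  proof
    fix v
    have "vnorm d (X y (foldr X ys v)) \<le> c * vnorm d (foldr X ys v)"
      using Cons.prems by (simp add: op_bound_def)
    also have "\<dots> \<le> c * (c ^ length ys * vnorm d v)"
      using Cons assms(2) by (intro mult_left_mono) (auto simp: op_bound_def)
    finally show "vnorm d (foldr X (y # ys) v) \<le> c ^ length (y # ys) * vnorm d v"
      by (simp add: mult_ac)
  qed
qed (simp add: op_bound_def)

lemma ip_sum_left: "ip d (\<Sum>k\<in>S. u k) v = (\<Sum>k\<in>S. ip d (u k) v)"
  unfolding ip_def sum_fun_apply cnj_sum sum_distrib_right by (rule sum.swap)

lemma ip_sum_right: "ip d u (\<Sum>k\<in>S. v k) = (\<Sum>k\<in>S. ip d u (v k))"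
  unfolding ip_def sum_fun_apply sum_distrib_left by (rule sum.swap)

lemma self_adjoint_sum:
  assumes "\<And>k. k \<in> S \<Longrightarrow> self_adjoint d (T k)"
  shows "self_adjoint d (\<lambda>v. \<Sum>k\<in>S. T k v)"
  using assms by (auto simp: self_adjoint_def ip_sum_left ip_sum_right intro!: sum.cong)

lemma expval_sum: "expval d \<rho> (\<lambda>v. \<Sum>k\<in>S. T k v) = (\<Sum>k\<in>S. expval d \<rho> (T k))"
proof -
  have "(\<Sum>i<d. \<Sum>j<d. \<rho> i j * (\<Sum>k\<in>S. T k (basis_vec i)) j)
      = (\<Sum>i<d. \<Sum>j<d. \<Sum>k\<in>S. \<rho> i j * T k (basis_vec i) j)"
    by (simp add: sum_fun_apply sum_distrib_left)
  also have "\<dots> = (\<Sum>i<d. \<Sum>k\<in>S. \<Sum>j<d. \<rho> i j * T k (basis_vec i) j)"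
    by (intro sum.cong refl sum.swap)
  also have "\<dots> = (\<Sum>k\<in>S. \<Sum>i<d. \<Sum>j<d. \<rho> i j * T k (basis_vec i) j)"
    by (rule sum.swap)
  finally show ?thesis by (simp add: expval_def)
qed

lemma expval_diff_scale:
  "expval d \<rho> (\<lambda>v i. T v i - of_real c * U v i) = expval d \<rho> T - c * expval d \<rho> U"
proof -
  have "(\<Sum>i<d. \<Sum>j<d. \<rho> i j * (T (basis_vec i) j - of_real c * U (basis_vec i) j))
     = (\<Sum>i<d. \<Sum>j<d. \<rho> i j * T (basis_vec i) j)
       - of_real c * (\<Sum>i<d. \<Sum>j<d. \<rho> i j * U (basis_vec i) j)"
    unfolding sum_distrib_left sum_subtractf[symmetric]
    by (intro sum.cong refl) (simp add: algebra_simps)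
  then show ?thesis by (simp add: expval_def del: Re_sum)
qed

text \<open>\<open>moment_bound\<close> for each diagonal entry separately: a product of
  \<open>2 * p\<close> operators of norm at most \<open>c\<close> has entries at most
  \<open>c ^ (2 * p)\<close>. The factor \<open>d\<close> counts the diagonal entries.\<close>

lemma op_trace_moment_bound:
  fixes S :: "'k set"
  assumes fin: "finite S" "finite Y" and p: "p > 0"
    and add: "\<And>y. y \<in> Y \<Longrightarrow> Modules.additive (X y)"
    and mean: "\<And>v. (\<Sum>y\<in>Y. X y v) = 0"
    and bound: "\<And>y. y \<in> Y \<Longrightarrow> op_bound d c (X y)" and c: "c \<ge> 0"
  shows "(\<Sum>f\<in>Pi\<^sub>E S (\<lambda>_. Y). op_trace d ((\<lambda>v. \<Sum>k\<in>S. X (f k) v) ^^ (2 * p)))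
           \<le> real (card Y ^ card S) * (real d * (real (card S ^ p * p ^ (2 * p)) * c ^ (2 * p)))"
proof -
  let ?B = "real (card Y ^ card S) * (real (card S ^ p * p ^ (2 * p)) * c ^ (2 * p))"
  have "(\<Sum>f\<in>Pi\<^sub>E S (\<lambda>_. Y). op_trace d ((\<lambda>v. \<Sum>k\<in>S. X (f k) v) ^^ (2 * p)))
      = (\<Sum>i<d. \<Sum>f\<in>Pi\<^sub>E S (\<lambda>_. Y). Re (((\<lambda>v. \<Sum>k\<in>S. X (f k) v) ^^ (2 * p)) (basis_vec i) i))"
    unfolding op_trace_def by (rule sum.swap)
  also have "\<dots> \<le> (\<Sum>i<d. ?B)"
  proof (intro sum_mono)
    fix i assume "i \<in> {..<d}"
    then have i: "i < d" by simp
    have L: "Modules.additive (\<lambda>v :: nat \<Rightarrow> complex. Re (v i))"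
      by (simp add: Modules.additive_def)
    have B: "Re (foldr X ys (basis_vec i) i) \<le> c ^ (2 * p)"
      if "set ys \<subseteq> Y" "length ys = 2 * p" for ys
    proof -
      have "Re (foldr X ys (basis_vec i) i) \<le> vnorm d (foldr X ys (basis_vec i))"
        using norm_le_vnorm[OF i, of "foldr X ys (basis_vec i)"] complex_Re_le_cmod order_trans by blast
      also have "\<dots> \<le> c ^ length ys * vnorm d (basis_vec i)"
        using op_bound_foldr[of ys d c X] bound that(1) c by (auto simp: op_bound_def)
      finally show ?thesis using that(2) i by (simp add: vnorm_basis_vec)
    qed
    show "(\<Sum>f\<in>Pi\<^sub>E S (\<lambda>_. Y). Re (((\<lambda>v. \<Sum>k\<in>S. X (f k) v) ^^ (2 * p)) (basis_vec i) i)) \<le> ?B"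
      using moment_bound[OF fin p add mean L, where e = "basis_vec i" and B = "c ^ (2 * p)"] B c by simp
  qed
  finally show ?thesis by (simp add: mult_ac)
qed

text \<open>First moment method: some sample has a sum of traces over \<open>I\<close> no larger
  than the average, and since the traces are nonnegative this bounds each of them. The cost of
  treating all indices at once is the total dimension.\<close>

lemma exists_sample_traces_le:
  fixes S :: "'k set" and Y :: "'y set" and d :: "'l \<Rightarrow> nat"
  assumes fin: "finite S" "finite Y" "finite I" and Y: "Y \<noteq> {}" and p: "p > 0"
    and add: "\<And>l y. l \<in> I \<Longrightarrow> y \<in> Y \<Longrightarrow> Modules.additive (X l y)"
    and mean: "\<And>l v. l \<in> I \<Longrightarrow> (\<Sum>y\<in>Y. X l y v) = 0"
    and sa: "\<And>l y. l \<in> I \<Longrightarrow> y \<in> Y \<Longrightarrow> self_adjoint (d l) (X l y)"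
    and bound: "\<And>l y. l \<in> I \<Longrightarrow> y \<in> Y \<Longrightarrow> op_bound (d l) c (X l y)" and c: "c \<ge> 0"
  shows "\<exists>f\<in>Pi\<^sub>E S (\<lambda>_. Y). \<forall>l\<in>I. op_trace (d l) ((\<lambda>v. \<Sum>k\<in>S. X l (f k) v) ^^ (2 * p))
           \<le> real (\<Sum>l\<in>I. d l) * (real (card S ^ p * p ^ (2 * p)) * c ^ (2 * p))"
proof -
  let ?F = "Pi\<^sub>E S (\<lambda>_. Y)"
  let ?tr = "\<lambda>f l. op_trace (d l) ((\<lambda>v. \<Sum>k\<in>S. X l (f k) v) ^^ (2 * p))"
  let ?C = "real (card S ^ p * p ^ (2 * p)) * c ^ (2 * p)"
  let ?R = "real (\<Sum>l\<in>I. d l) * ?C"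
  have nonneg: "0 \<le> ?tr f l" if "f \<in> ?F" "l \<in> I" for f l
    using that by (intro op_trace_even_power_nonneg self_adjoint_sum sa) auto
  have "finite ?F" "?F \<noteq> {}" using fin Y by (auto intro: finite_PiE simp: PiE_eq_empty_iff)
  have "\<exists>f\<in>?F. (\<Sum>l\<in>I. ?tr f l) \<le> ?R"
  proof (rule ccontr)
    assume "\<not> ?thesis"
    then have "(\<Sum>f\<in>?F. ?R) < (\<Sum>f\<in>?F. \<Sum>l\<in>I. ?tr f l)"
      using \<open>finite ?F\<close> \<open>?F \<noteq> {}\<close> by (intro sum_strict_mono) auto
    also have "\<dots> = (\<Sum>l\<in>I. \<Sum>f\<in>?F. ?tr f l)"
      by (rule sum.swap)
    also have "\<dots> \<le> (\<Sum>l\<in>I. real (card Y ^ card S) * (real (d l) * ?C))"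
      using fin by (intro sum_mono op_trace_moment_bound[OF fin(1,2) p add mean bound c])
    also have "\<dots> = (\<Sum>f\<in>?F. ?R)"
      using fin by (simp add: card_PiE sum_distrib_left sum_distrib_right)
    finally show False by simp
  qed
  then obtain f where f: "f \<in> ?F" "(\<Sum>l\<in>I. ?tr f l) \<le> ?R" by blast
  have "?tr f l \<le> ?R" if "l \<in> I" for l
    using member_le_sum[OF that, of "?tr f"] nonneg f fin by fastforce
  with f(1) show ?thesis by blast
qed

text \<open>The sample is fixed before the state: its trace bounds control every
  \<open>\<rho>\<close> through \<open>expval_power_le_trace\<close>, so no net over states is
  taken.\<close>

lemma exists_sample_expval_close:
  fixes S :: "'k set" and Y :: "'y set" and d :: "'l \<Rightarrow> nat"
  assumes fin: "finite S" "finite Y" "finite I" and ne: "S \<noteq> {}" "Y \<noteq> {}" and p: "p = 2 ^ r"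
    and add: "\<And>l y. l \<in> I \<Longrightarrow> y \<in> Y \<Longrightarrow> Modules.additive (A l y)"
    and sa: "\<And>l y. l \<in> I \<Longrightarrow> y \<in> Y \<Longrightarrow> self_adjoint (d l) (A l y)"
    and bound: "\<And>l y. l \<in> I \<Longrightarrow> y \<in> Y \<Longrightarrow> op_bound (d l) 1 (A l y)"
  shows "\<exists>f\<in>Pi\<^sub>E S (\<lambda>_. Y). \<forall>l\<in>I. \<forall>\<rho>. psd_trace_one (d l) \<rho> \<longrightarrow>
      ((\<Sum>k\<in>S. expval (d l) \<rho> (A l (f k))) / card S - (\<Sum>y\<in>Y. expval (d l) \<rho> (A l y)) / card Y) ^ (2 * p)
           \<le> real (\<Sum>l\<in>I. d l) * (4 * real p ^ 2 / card S) ^ p"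
proof -
  define N where "N = real (card Y)"
  have N: "N > 0" using fin ne by (simp add: N_def card_gt_0_iff)
  define M where "M l v = (\<Sum>y\<in>Y. A l y v)" for l v
  \<comment> \<open>The operators centred at their mean over \<open>Y\<close>.\<close>
  define X where "X l y v = (\<lambda>i. A l y v i - of_real (1 / N) * M l v i)" for l y v
  have sumA: "Modules.additive (M l)" if "l \<in> I" for l
    using add[OF that] by (auto simp: Modules.additive_def M_def sum.distrib)
  have addX: "Modules.additive (X l y)" if "l \<in> I" "y \<in> Y" for l y
    using add[OF that] sumA[OF that(1)]
    by (auto simp: Modules.additive_def X_def fun_eq_iff algebra_simps add_divide_distrib)
  have meanX: "(\<Sum>y\<in>Y. X l y v) = 0" for l v
  proof
    fix i
    have "(\<Sum>y\<in>Y. X l y v) i = M l v i - of_nat (card Y) * (of_real (1 / N) * M l v i)"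
      by (simp add: sum_fun_apply X_def sum_subtractf M_def)
    then show "(\<Sum>y\<in>Y. X l y v) i = 0 i"
      using N by (simp add: N_def)
  qed
  have saM: "self_adjoint (d l) (M l)" if "l \<in> I" for l
    unfolding M_def using that by (intro self_adjoint_sum sa)
  have saX: "self_adjoint (d l) (X l y)" if "l \<in> I" "y \<in> Y" for l y
  proof -
    have "ip (d l) (X l y u) v = ip (d l) (A l y u) v - of_real (1 / N) * ip (d l) (M l u) v" for u v
      unfolding ip_def X_def sum_distrib_left sum_subtractf[symmetric]
      by (intro sum.cong refl) (simp add: algebra_simps)
    moreover have "ip (d l) u (X l y v) = ip (d l) u (A l y v) - of_real (1 / N) * ip (d l) u (M l v)" for u v
      unfolding ip_def X_def sum_distrib_left sum_subtractf[symmetric]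
      by (intro sum.cong refl) (simp add: algebra_simps)
    ultimately show ?thesis
      using sa[OF that] saM[OF that(1)] by (simp add: self_adjoint_def)
  qed
  \<comment> \<open>Both the operator and the mean have norm at most 1, so centring at most doubles
    the bound.\<close>
  have bdX: "op_bound (d l) 2 (X l y)" if "l \<in> I" "y \<in> Y" for l y
    unfolding op_bound_def
  proof
    fix v
    have "X l y v = A l y v + (\<lambda>i. - of_real (1 / N) * M l v i)"
      by (simp add: X_def fun_eq_iff)
    then have "vnorm (d l) (X l y v) \<le> vnorm (d l) (A l y v) + vnorm (d l) (\<lambda>i. - of_real (1 / N) * M l v i)"
      using vnorm_add by metis
    also have "vnorm (d l) (\<lambda>i. - of_real (1 / N) * M l v i) = 1 / N * vnorm (d l) (M l v)"
      using N by (subst vnorm_scale) (simp add: norm_divide)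
    also have "vnorm (d l) (M l v) \<le> (\<Sum>y\<in>Y. vnorm (d l) (A l y v))"
      unfolding M_def by (rule vnorm_sum)
    also have "\<dots> \<le> (\<Sum>y\<in>Y. vnorm (d l) v)"
      using bound[OF that(1)] by (intro sum_mono) (auto simp: op_bound_def)
    also have "\<dots> = N * vnorm (d l) v" by (simp add: N_def)
    also have "vnorm (d l) (A l y v) \<le> vnorm (d l) v"
      using bound[OF that] by (simp add: op_bound_def)
    finally show "vnorm (d l) (X l y v) \<le> 2 * vnorm (d l) v"
      using N by (simp add: divide_right_mono)
  qed
  have "p > 0" using p by simp
  obtain f where f: "f \<in> Pi\<^sub>E S (\<lambda>_. Y)" and
    tr: "\<And>l. l \<in> I \<Longrightarrow> op_trace (d l) ((\<lambda>v. \<Sum>k\<in>S. X l (f k) v) ^^ (2 * p))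
           \<le> real (\<Sum>l\<in>I. d l) * (real (card S ^ p * p ^ (2 * p)) * 2 ^ (2 * p))"
    using exists_sample_traces_le[where X = X and d = d and c = 2, OF fin ne(2) \<open>p > 0\<close> addX meanX saX bdX]
    by auto
  define K where "K = real (card S)"
  have K: "K > 0" using fin ne by (simp add: K_def card_gt_0_iff)
  show ?thesis
  proof (intro bexI[OF _ f] ballI allI impI)
    fix l \<rho> assume l: "l \<in> I" and \<rho>: "psd_trace_one (d l) \<rho>"
    let ?e = "expval (d l) \<rho>"
    let ?T = "\<lambda>v. \<Sum>k\<in>S. X l (f k) v"
    have M: "?e (M l) = (\<Sum>y\<in>Y. ?e (A l y))"
      unfolding M_def[abs_def] by (rule expval_sum)
    have "?e ?T = (\<Sum>k\<in>S. ?e (A l (f k)) - 1 / N * ?e (M l))"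
      unfolding expval_sum by (simp only: X_def[abs_def] expval_diff_scale)
    also have "\<dots> = K * ((\<Sum>k\<in>S. ?e (A l (f k))) / K - (\<Sum>y\<in>Y. ?e (A l y)) / N)"
      using K by (simp add: sum_subtractf M algebra_simps) (simp add: K_def)
    finally have eq: "?e ?T = K * ((\<Sum>k\<in>S. ?e (A l (f k))) / K - (\<Sum>y\<in>Y. ?e (A l y)) / N)" (is "_ = K * ?D") .
    have "self_adjoint (d l) ?T"
      using f l by (intro self_adjoint_sum saX) auto
    from expval_power_le_trace[OF \<rho> this, of r]
    have "(K * ?D) ^ (2 * p) \<le> op_trace (d l) (?T ^^ (2 * p))"
      by (simp only: eq p power_Suc)
    also have "\<dots> \<le> real (\<Sum>l\<in>I. d l) * (real (card S ^ p * p ^ (2 * p)) * 2 ^ (2 * p))"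
      by (rule tr[OF l])
    \<comment> \<open>Passing from the sum over the sample to its average divides by
      \<open>K ^ (2 * p)\<close>, while the word count contributes only \<open>K ^ p\<close>; the
      surplus is the decay in \<open>K\<close>.\<close>
    also have "\<dots> = K ^ (2 * p) * (real (\<Sum>l\<in>I. d l) * (4 * real p ^ 2 / K) ^ p)"
      using K by (simp add: K_def[symmetric] power_mult power_mult_distrib power_divide power2_eq_square)
    finally have "?D ^ (2 * p) \<le> real (\<Sum>l\<in>I. d l) * (4 * real p ^ 2 / K) ^ p"
      using K by (simp add: power_mult_distrib)
    then show "((\<Sum>k\<in>S. ?e (A l (f k))) / card S - (\<Sum>y\<in>Y. ?e (A l y)) / card Y) ^ (2 * p)
        \<le> real (\<Sum>l\<in>I. d l) * (4 * real p ^ 2 / card S) ^ p"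
      by (simp add: K_def N_def)
  qed
qed

section \<open>Acceptance operators of circuits\<close>

text \<open>\<open>W\<close> is an isometry from dimension \<open>d\<close> to dimension
  \<open>N\<close>. Rectangular shapes cover both unitaries and the column selections that fix the
  classical input of a circuit.\<close>

definition orthonormal_cols :: "nat \<Rightarrow> nat \<Rightarrow> (nat \<Rightarrow> nat \<Rightarrow> complex) \<Rightarrow> bool" where
  "orthonormal_cols N d W \<longleftrightarrow>
     (\<forall>i<d. \<forall>j<d. (\<Sum>x<N. cnj (W x i) * W x j) = (if i = j then 1 else 0))"

text \<open>The operator \<open>W\<^sup>* \<Pi> W\<close>, where \<open>\<Pi>\<close> projects onto the coordinates in \<open>P\<close>.\<close>

definition compress :: "nat \<Rightarrow> nat set \<Rightarrow> (nat \<Rightarrow> nat \<Rightarrow> complex) \<Rightarrow> (nat \<Rightarrow> complex) \<Rightarrow> nat \<Rightarrow> complex" where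
  "compress d P W v = (\<lambda>i. \<Sum>x\<in>P. cnj (W x i) * (\<Sum>j<d. W x j * v j))"

lemma vnorm_square: "(vnorm d v)\<^sup>2 = Re (ip d v v)"
  by (simp add: vnorm_def L2_set_def ip_self sum_nonneg)

lemma ip_orthonormal:
  assumes "orthonormal_cols N d W"
  shows "ip N (\<lambda>x. \<Sum>i<d. W x i * u i) (\<lambda>x. \<Sum>j<d. W x j * v j) = ip d u v"
proof -
  have "ip N (\<lambda>x. \<Sum>i<d. W x i * u i) (\<lambda>x. \<Sum>j<d. W x j * v j)
      = (\<Sum>x<N. \<Sum>i<d. \<Sum>j<d. cnj (u i) * (v j * (cnj (W x i) * W x j)))"
    unfolding ip_def cnj_sum sum_product by (intro sum.cong refl) simp
  also have "\<dots> = (\<Sum>i<d. \<Sum>j<d. \<Sum>x<N. cnj (u i) * (v j * (cnj (W x i) * W x j)))"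
    by (subst sum.swap, rule sum.cong[OF refl], rule sum.swap)
  also have "\<dots> = (\<Sum>i<d. \<Sum>j<d. cnj (u i) * (v j * (\<Sum>x<N. cnj (W x i) * W x j)))"
    by (simp only: sum_distrib_left)
  also have "\<dots> = (\<Sum>i<d. \<Sum>j<d. cnj (u i) * (v j * (if i = j then 1 else 0)))"
    using assms unfolding orthonormal_cols_def by (intro sum.cong refl) auto
  also have "\<dots> = ip d u v"
    by (simp add: ip_def if_distrib cong: if_cong)
  finally show ?thesis .
qed

lemma additive_compress: "Modules.additive (compress d P W)"
  by (simp add: Modules.additive_def compress_def fun_eq_iff algebra_simps sum.distrib)

text \<open>The adjoint of \<open>W\<close> is moved to the other side. Self-adjointness and the
  norm bound are both read off from this symmetric form.\<close>

lemma ip_compress: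
  "ip d u (compress d P W v) = (\<Sum>x\<in>P. cnj (\<Sum>i<d. W x i * u i) * (\<Sum>j<d. W x j * v j))"
proof -
  define S where "S x = (\<Sum>j<d. W x j * v j)" for x
  have "ip d u (compress d P W v) = (\<Sum>i<d. \<Sum>x\<in>P. cnj (W x i * u i) * S x)"
    unfolding ip_def compress_def S_def[symmetric] sum_distrib_left
    by (intro sum.cong refl) (simp add: mult_ac)
  also have "\<dots> = (\<Sum>x\<in>P. \<Sum>i<d. cnj (W x i * u i) * S x)"
    by (rule sum.swap)
  also have "\<dots> = (\<Sum>x\<in>P. cnj (\<Sum>i<d. W x i * u i) * S x)"
    by (simp only: cnj_sum sum_distrib_right)
  finally show ?thesis unfolding S_def .
qed

lemma ip_cnj: "cnj (ip d u v) = ip d v u"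
  by (simp add: ip_def mult.commute)

lemma self_adjoint_compress: "self_adjoint d (compress d P W)"
  unfolding self_adjoint_def
proof (intro allI)
  fix u v
  have "ip d (compress d P W u) v = cnj (ip d v (compress d P W u))"
    by (simp add: ip_cnj)
  also have "\<dots> = ip d u (compress d P W v)"
    unfolding ip_compress by (simp add: mult.commute)
  finally show "ip d (compress d P W u) v = ip d u (compress d P W v)" .
qed

text \<open>For the image \<open>?w\<close> of \<open>v\<close>, the square of its norm is the inner
  product of \<open>W ?w\<close> and \<open>W v\<close> restricted to \<open>P\<close>.
  Cauchy-Schwarz and the isometry property bound it by the product of the norms of \<open>?w\<close>
  and \<open>v\<close>, and one factor cancels.\<close>

lemma op_bound_compress:
  assumes W: "orthonormal_cols N d W" and P: "P \<subseteq> {..<N}"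
  shows "op_bound d 1 (compress d P W)"
  unfolding op_bound_def
proof
  fix v
  define Wv where "Wv v = (\<lambda>x. \<Sum>j<d. W x j * v j)" for v :: "nat \<Rightarrow> complex"
  have iso: "vnorm N (Wv u) = vnorm d u" for u
  proof -
    have "(vnorm N (Wv u))\<^sup>2 = (vnorm d u)\<^sup>2"
      unfolding vnorm_square Wv_def ip_orthonormal[OF W] ..
    then show ?thesis by (simp add: vnorm_nonneg)
  qed
  let ?w = "compress d P W v"
  have "(vnorm d ?w)\<^sup>2 \<le> cmod (ip d ?w ?w)"
    unfolding vnorm_square by (rule complex_Re_le_cmod)
  also have "\<dots> = cmod (\<Sum>x\<in>P. cnj (Wv ?w x) * Wv v x)"
    by (subst ip_compress) (simp add: Wv_def)
  also have "\<dots> \<le> (\<Sum>x\<in>P. \<bar>cmod (Wv ?w x)\<bar> * \<bar>cmod (Wv v x)\<bar>)"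
    by (rule sum_norm_le) (simp add: norm_mult)
  also have "\<dots> \<le> (\<Sum>x<N. \<bar>cmod (Wv ?w x)\<bar> * \<bar>cmod (Wv v x)\<bar>)"
    using P by (intro sum_mono2) auto
  also have "\<dots> \<le> vnorm N (Wv ?w) * vnorm N (Wv v)"
    unfolding vnorm_def by (rule L2_set_mult_ineq)
  finally have "vnorm d ?w * vnorm d ?w \<le> vnorm d ?w * vnorm d v"
    by (simp add: iso power2_eq_square)
  then show "vnorm d ?w \<le> 1 * vnorm d v"
    using vnorm_nonneg[of d ?w] vnorm_nonneg[of d v]
    by (cases "vnorm d ?w = 0") (auto simp: mult_le_cancel_left)
qed

lemma expval_compress:
  "expval d \<rho> (compress d P W) = Re (\<Sum>i<d. \<Sum>j<d. \<rho> i j * (\<Sum>x\<in>P. W x i * cnj (W x j)))"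
proof -
  have "compress d P W (basis_vec i) j = (\<Sum>x\<in>P. W x i * cnj (W x j))" if "i < d" for i j
    using that by (simp add: compress_def basis_vec_def if_distrib mult.commute cong: if_cong)
  then show ?thesis by (simp add: expval_def)
qed

section \<open>Unitarity of gates and circuits\<close>

lemma qbit_eq_of_bool: "qbit x i = of_bool (bit x i)"
  by (simp add: qbit_def bit_iff_odd mod_2_eq_odd)

lemma eq_if_qbits_eq:
  assumes "x < 2 ^ n" "y < 2 ^ n" "\<And>k. k < n \<Longrightarrow> qbit x k = qbit y k"
  shows "x = y"
proof -
  have "take_bit n x = take_bit n y"
    using assms(3)[unfolded qbit_eq_of_bool of_bool_eq_iff]
    by (intro bit_eqI) (auto simp: bit_take_bit_iff)
  then show ?thesis using assms(1,2) by (simp add: take_bit_nat_eq_self)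
qed

lemma exists_qbit_update:
  assumes "y < 2 ^ n" "i < n" "c < 2"
  obtains x where "x < 2 ^ n" "\<And>k. k \<noteq> i \<Longrightarrow> qbit x k = qbit y k" "qbit x i = c"
proof
  let ?x = "if c = 1 then set_bit i y else unset_bit i y"
  have y: "take_bit n y = y" using assms by (simp add: take_bit_nat_eq_self)
  have "take_bit n ?x = ?x"
    using assms(2) y by (simp add: take_bit_set_bit_eq take_bit_unset_bit_eq)
  then show "?x < 2 ^ n" by (simp only: take_bit_nat_eq_self_iff)
  show "qbit ?x k = qbit y k" if "k \<noteq> i" for k
    using that by (auto simp: qbit_eq_of_bool bit_set_bit_iff bit_unset_bit_iff)
  show "qbit ?x i = c"
    using assms(3) by (auto simp: qbit_eq_of_bool bit_set_bit_iff bit_unset_bit_iff)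
qed

lemma qbit_less_2: "qbit x i < 2"
  by (simp add: qbit_def)

text \<open>Columns \<open>y\<close> and \<open>y'\<close> have overlapping support only if they
  agree off qubit \<open>i\<close>. The common support is then parametrised by the value of that
  qubit, and the inner product is that of two columns of the 2 by 2 matrix \<open>h\<close>.\<close>

lemma orthonormal_single_qubit:
  assumes i: "i < n"
    and h: "\<And>a b. a < 2 \<Longrightarrow> b < 2 \<Longrightarrow> (\<Sum>c<2::nat. cnj (h c a) * h c b) = (if a = b then 1 else 0)"
  shows "orthonormal_cols (2 ^ n) (2 ^ n)
    (\<lambda>x y. if \<forall>k<n. k \<noteq> i \<longrightarrow> qbit x k = qbit y k then h (qbit x i) (qbit y i) else 0)"
  unfolding orthonormal_cols_def
proof (intro allI impI)
  fix y y' :: nat assume y: "y < 2 ^ n" "y' < 2 ^ n"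
  define agree where "agree x y \<longleftrightarrow> (\<forall>k<n. k \<noteq> i \<longrightarrow> qbit x k = qbit y k)" for x y
  let ?A = "{x. x < 2 ^ n \<and> agree x y}"
  have "(\<Sum>x<2 ^ n. cnj (if agree x y then h (qbit x i) (qbit y i) else 0) *
                    (if agree x y' then h (qbit x i) (qbit y' i) else 0))
      = (\<Sum>x\<in>?A. if agree y y' then cnj (h (qbit x i) (qbit y i)) * h (qbit x i) (qbit y' i) else 0)"
  proof (rule sum.mono_neutral_cong_right)
    have "agree x y' \<longleftrightarrow> agree y y'" if "agree x y" for x
      using that by (simp add: agree_def)
    then show "cnj (if agree x y then h (qbit x i) (qbit y i) else 0) * (if agree x y' then h (qbit x i) (qbit y' i) else 0)
        = (if agree y y' then cnj (h (qbit x i) (qbit y i)) * h (qbit x i) (qbit y' i) else 0)" if "x \<in> ?A" for x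
      using that by simp
  qed auto
  also have "\<dots> = (if agree y y' then (\<Sum>x\<in>?A. cnj (h (qbit x i) (qbit y i)) * h (qbit x i) (qbit y' i)) else 0)"
    by simp
  also have "(\<Sum>x\<in>?A. cnj (h (qbit x i) (qbit y i)) * h (qbit x i) (qbit y' i))
      = (\<Sum>c<2. cnj (h c (qbit y i)) * h c (qbit y' i))"
  proof (rule sum.reindex_bij_betw[where h = "\<lambda>x. qbit x i"])
    have "inj_on (\<lambda>x. qbit x i) ?A"
    proof (rule inj_onI)
      fix x x' assume x: "x \<in> ?A" "x' \<in> ?A" "qbit x i = qbit x' i"
      have "qbit x k = qbit x' k" if "k < n" for k
        using x that by (cases "k = i") (simp_all add: agree_def)
      then show "x = x'" using x by (intro eq_if_qbits_eq[of x n x']) simp_all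
    qed
    moreover have "c \<in> (\<lambda>x. qbit x i) ` ?A" if c: "c < 2" for c
    proof -
      obtain x where "x < 2 ^ n" "\<And>k. k \<noteq> i \<Longrightarrow> qbit x k = qbit y k" "qbit x i = c"
        using exists_qbit_update[OF y(1) i c] by blast
      then show ?thesis by (intro image_eqI[of _ _ x]) (simp_all add: agree_def)
    qed
    ultimately show "bij_betw (\<lambda>x. qbit x i) ?A {..<2}"
      by (auto simp: bij_betw_def qbit_less_2)
  qed
  also have "\<dots> = (if qbit y i = qbit y' i then 1 else 0)"
    by (rule h) (rule qbit_less_2)+
  also have "(if agree y y' then if qbit y i = qbit y' i then 1 else 0 else 0) = (if y = y' then 1 else (0 :: complex))"
    using eq_if_qbits_eq[OF y] by (auto simp: agree_def)
  finally show "(\<Sum>x<2 ^ n. cnj (if \<forall>k<n. k \<noteq> i \<longrightarrow> qbit x k = qbit y k then h (qbit x i) (qbit y i) else 0) *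
      (if \<forall>k<n. k \<noteq> i \<longrightarrow> qbit x k = qbit y' k then h (qbit x i) (qbit y' i) else 0))
      = (if y = y' then 1 else 0)"
    unfolding agree_def .
qed

lemma had_entry_orthonormal:
  assumes "a < 2" "b < 2"
  shows "(\<Sum>c<2::nat. cnj (had_entry c a) * had_entry c b) = (if a = b then 1 else 0)"
proof -
  have "complex_of_real (sqrt 2) * complex_of_real (sqrt 2) = 2"
    by (simp flip: of_real_mult)
  with assms show ?thesis
    by (auto simp: had_entry_def less_2_cases_iff numeral_2_eq_2 field_simps)
qed

lemma t_entry_orthonormal:
  assumes "a < 2" "b < 2"
  shows "(\<Sum>c<2::nat. cnj (t_entry c a) * t_entry c b) = (if a = b then 1 else 0)"
proof -
  have "cnj (cis t) * cis t = 1" for t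
    by (simp add: cis_cnj cis_mult)
  with assms show ?thesis
    by (auto simp: t_entry_def less_2_cases_iff numeral_2_eq_2)
qed

text \<open>A permutation matrix: column \<open>y\<close> has a single 1. No two columns share its
  row because the control differs from the target and so survives, which makes the flip of the
  target reversible.\<close>

lemma orthonormal_cnot:
  assumes c: "c < n" and t: "t < n" and ct: "c \<noteq> t"
  shows "orthonormal_cols (2 ^ n) (2 ^ n)
    (\<lambda>x y. if (\<forall>k<n. k \<noteq> t \<longrightarrow> qbit x k = qbit y k) \<and> qbit x t = (qbit y t + qbit y c) mod 2 then 1 else 0)"
  unfolding orthonormal_cols_def
proof (intro allI impI)
  fix y y' :: nat assume y: "y < 2 ^ n" "y' < 2 ^ n"
  define R where "R x y \<longleftrightarrow> (\<forall>k<n. k \<noteq> t \<longrightarrow> qbit x k = qbit y k) \<and> qbit x t = (qbit y t + qbit y c) mod 2" for x y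
  obtain x where x: "x < 2 ^ n" "\<And>k. k \<noteq> t \<Longrightarrow> qbit x k = qbit y k" "qbit x t = (qbit y t + qbit y c) mod 2"
    using exists_qbit_update[OF y(1) t, of "(qbit y t + qbit y c) mod 2"] by auto
  have Rx: "R z y \<longleftrightarrow> z = x" if "z < 2 ^ n" for z
  proof
    assume R: "R z y"
    have "qbit z k = qbit x k" if "k < n" for k
      using R x that by (cases "k = t") (simp_all add: R_def)
    then show "z = x" using x that by (intro eq_if_qbits_eq[of z n x]) simp_all
  qed (use x in \<open>simp add: R_def\<close>)
  have inj: "y = y'" if "R x y'"
  proof (rule eq_if_qbits_eq[OF y])
    fix k assume k: "k < n"
    have "qbit y c = qbit y' c" using that x(2)[of c] c ct by (auto simp: R_def)
    moreover have "(qbit y t + qbit y c) mod 2 = (qbit y' t + qbit y' c) mod 2"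
      using that x(3) by (auto simp: R_def)
    ultimately have "qbit y t = qbit y' t"
      by (cases "bit y t"; cases "bit y' t"; cases "bit y c"; cases "bit y' c")
        (simp_all add: qbit_eq_of_bool)
    then show "qbit y k = qbit y' k"
      using that x(2)[of k] k by (cases "k = t") (auto simp: R_def)
  qed
  have "(\<Sum>z<2 ^ n. cnj (if R z y then 1 else 0) * (if R z y' then 1 else 0))
     = (\<Sum>z<2 ^ n. if z = x then (if R x y' then 1 else 0) else (0 :: complex))"
    by (intro sum.cong refl) (auto simp: Rx)
  also have "\<dots> = (if R x y' then 1 else 0)" using x(1) by simp
  also have "\<dots> = (if y = y' then 1 else 0)" using inj Rx[OF x(1)] by auto
  finally show "(\<Sum>x<2 ^ n. cnj (if (\<forall>k<n. k \<noteq> t \<longrightarrow> qbit x k = qbit y k) \<and> qbit x t = (qbit y t + qbit y c) mod 2 then 1 else 0) *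
      (if (\<forall>k<n. k \<noteq> t \<longrightarrow> qbit x k = qbit y' k) \<and> qbit x t = (qbit y' t + qbit y' c) mod 2 then 1 else 0))
      = (if y = y' then 1 else (0 :: complex))"
    unfolding R_def .
qed

lemma orthonormal_cols_cong:
  assumes "\<And>x y. x < N \<Longrightarrow> y < d \<Longrightarrow> V x y = W x y"
  shows "orthonormal_cols N d V \<longleftrightarrow> orthonormal_cols N d W"
  using assms by (auto simp: orthonormal_cols_def)

lemma orthonormal_gate_mat:
  assumes "wf_gate n g"
  shows "orthonormal_cols (2 ^ n) (2 ^ n) (\<lambda>x y. gate_mat n g $$ (x, y))"
proof (cases g)
  case (Had i)
  with assms have "i < n" by (simp add: wf_gate_def)
  from orthonormal_single_qubit[OF this had_entry_orthonormal] show ?thesis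
    by (subst orthonormal_cols_cong) (auto simp: gate_mat_def Had)
next
  case (Tgate i)
  with assms have "i < n" by (simp add: wf_gate_def)
  from orthonormal_single_qubit[OF this t_entry_orthonormal] show ?thesis
    by (subst orthonormal_cols_cong) (auto simp: gate_mat_def Tgate)
next
  case (CNOT c t)
  with assms have "c < n" "t < n" "c \<noteq> t" by (simp_all add: wf_gate_def)
  from orthonormal_cnot[OF this] show ?thesis
    by (subst orthonormal_cols_cong) (auto simp: gate_mat_def CNOT)
qed

lemma gate_mat_carrier: "gate_mat n g \<in> carrier_mat (2 ^ n) (2 ^ n)"
  by (simp add: gate_mat_def)

lemma mat_mult_index:
  assumes "A \<in> carrier_mat nr N" "B \<in> carrier_mat N nc" "x < nr" "y < nc"
  shows "(A * B) $$ (x, y) = (\<Sum>z<N. A $$ (x, z) * B $$ (z, y))"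
  using assms by (simp add: scalar_prod_def lessThan_atLeast0)

text \<open>Column \<open>j\<close> of \<open>A * B\<close> is \<open>A\<close> applied to column
  \<open>j\<close> of \<open>B\<close>, and \<open>A\<close> preserves inner products by
  \<open>ip_orthonormal\<close>.\<close>

lemma orthonormal_mult:
  assumes A: "A \<in> carrier_mat N N" "orthonormal_cols N N (\<lambda>x y. A $$ (x, y))"
    and B: "B \<in> carrier_mat N N" "orthonormal_cols N N (\<lambda>x y. B $$ (x, y))"
  shows "orthonormal_cols N N (\<lambda>x y. (A * B) $$ (x, y))"
proof -
  have "orthonormal_cols N N (\<lambda>x y. (A * B) $$ (x, y))
      \<longleftrightarrow> orthonormal_cols N N (\<lambda>x y. \<Sum>z<N. A $$ (x, z) * B $$ (z, y))"
    by (intro orthonormal_cols_cong mat_mult_index[OF A(1) B(1)])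
  also have \<dots>
    unfolding orthonormal_cols_def
  proof (intro allI impI)
    fix i j assume "i < N" "j < N"
    then show "(\<Sum>x<N. cnj (\<Sum>z<N. A $$ (x, z) * B $$ (z, i)) * (\<Sum>z<N. A $$ (x, z) * B $$ (z, j)))
        = (if i = j then 1 else 0)"
      using ip_orthonormal[OF A(2), unfolded ip_def, of "\<lambda>z. B $$ (z, i)" "\<lambda>z. B $$ (z, j)"] B(2)
      by (simp only: orthonormal_cols_def)
  qed
  finally show ?thesis .
qed

lemma circuit_unitary_orthonormal:
  assumes "\<And>g. g \<in> set gs \<Longrightarrow> wf_gate n g"
  shows "circuit_unitary n gs \<in> carrier_mat (2 ^ n) (2 ^ n)
    \<and> orthonormal_cols (2 ^ n) (2 ^ n) (\<lambda>x y. circuit_unitary n gs $$ (x, y))"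
  using assms
\<comment> \<open>Induction at the end of the list, since the \<open>foldl\<close> in
  \<open>circuit_unitary\<close> makes the last gate the leftmost factor.\<close>
proof (induction gs rule: rev_induct)
  case Nil
  have "orthonormal_cols (2 ^ n) (2 ^ n) (\<lambda>x y. 1\<^sub>m (2 ^ n) $$ (x, y))"
    by (auto simp: orthonormal_cols_def if_distrib cong: if_cong)
  then show ?case by (simp add: circuit_unitary_def)
next
  case (snoc g gs)
  then have IH: "circuit_unitary n gs \<in> carrier_mat (2 ^ n) (2 ^ n)"
    "orthonormal_cols (2 ^ n) (2 ^ n) (\<lambda>x y. circuit_unitary n gs $$ (x, y))"
    and g: "wf_gate n g" by auto
  have "circuit_unitary n (gs @ [g]) = gate_mat n g * circuit_unitary n gs"
    by (simp add: circuit_unitary_def)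
  then show ?case
    using orthonormal_mult[OF gate_mat_carrier orthonormal_gate_mat[OF g] IH]
      mult_carrier_mat[OF gate_mat_carrier IH(1)] by simp
qed

section \<open>Circuits with a fixed input as operators on the advice register\<close>

lemma enc_less: "enc y < 2 ^ length y"
proof -
  have "enc y \<le> (\<Sum>i<length y. 2 ^ i)"
    unfolding enc_def by (intro sum_mono) auto
  also have "\<dots> < 2 ^ length y"
    by (simp add: sum_power2 lessThan_atLeast0)
  finally show ?thesis .
qed

text \<open>The computational basis index of all wires when the input wires hold \<open>y\<close>,
  the advice wires hold basis state \<open>i\<close>, and the ancillas are 0.\<close>

definition advice_index :: "nat \<Rightarrow> bool list \<Rightarrow> nat \<Rightarrow> nat" where
  "advice_index lam y i = enc y + 2 ^ lam * i"

text \<open>The operator \<open>M\<close> of the given input \<open>y\<close>: the unitary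
  restricted to its columns at the advice indices of \<open>y\<close> is an isometry on the advice
  register, followed by measurement of wire 0.\<close>

definition accept_op ::
  "nat \<Rightarrow> nat \<Rightarrow> nat \<Rightarrow> gate list \<Rightarrow> bool list \<Rightarrow> (nat \<Rightarrow> complex) \<Rightarrow> nat \<Rightarrow> complex" where
  "accept_op lam m n gs y = compress (2 ^ m) {x. x < 2 ^ n \<and> qbit x 0 = 1}
     (\<lambda>x i. circuit_unitary n gs $$ (x, advice_index lam y i))"

lemma advice_index_less:
  assumes "length y = lam" "i < 2 ^ m" "lam + m \<le> n"
  shows "advice_index lam y i < 2 ^ n"
proof -
  have "advice_index lam y i < 2 ^ lam + 2 ^ lam * i"
    using enc_less[of y] assms by (simp add: advice_index_def)
  also have "\<dots> = 2 ^ lam * (i + 1)" by simp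
  also have "\<dots> \<le> 2 ^ lam * 2 ^ m" using assms(2) by (intro mult_le_mono) auto
  also have "\<dots> \<le> 2 ^ n" using assms(3) by (simp add: power_add[symmetric])
  finally show ?thesis .
qed

lemma advice_index_eq_iff: "advice_index lam y i = advice_index lam y j \<longleftrightarrow> i = j"
  by (simp add: advice_index_def)

text \<open>Distinct advice indices select distinct columns of a unitary, so the selected columns
  remain orthonormal.\<close>

lemma op_bound_accept_op:
  assumes "\<And>g. g \<in> set gs \<Longrightarrow> wf_gate n g" "length y = lam" "lam + m \<le> n"
  shows "op_bound (2 ^ m) 1 (accept_op lam m n gs y)"
  unfolding accept_op_def
proof (rule op_bound_compress)
  show "orthonormal_cols (2 ^ n) (2 ^ m) (\<lambda>x i. circuit_unitary n gs $$ (x, advice_index lam y i))"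
    using circuit_unitary_orthonormal[OF assms(1)] advice_index_less[OF assms(2) _ assms(3)]
    by (simp add: orthonormal_cols_def advice_index_eq_iff)
qed auto

lemma advice_index_div:
  assumes "length y = lam" "i < 2 ^ m"
  shows "advice_index lam y i mod 2 ^ lam = enc y" "advice_index lam y i div 2 ^ lam mod 2 ^ m = i"
    "advice_index lam y i div 2 ^ (lam + m) = 0"
  using enc_less[of y] advice_index_less[of y lam i m "lam + m"] assms
  by (auto simp: advice_index_def)

text \<open>The hypotheses are the support conditions in \<open>init_state\<close>, so entries of
  the initial state outside the advice indices vanish.\<close>

lemma advice_index_surj:
  assumes "x mod 2 ^ lam = enc y" "x div 2 ^ (lam + m) = 0"
  shows "x \<in> advice_index lam y ` {..<2 ^ m}"
proof
  show "x = advice_index lam y (x div 2 ^ lam)"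
    using assms(1) by (metis advice_index_def mod_mult_div_eq)
  have "x div 2 ^ lam div 2 ^ m = 0" using assms(2) by (simp add: power_add div_mult2_eq)
  then show "x div 2 ^ lam \<in> {..<2 ^ m}" by (simp add: div_eq_0_iff)
qed

lemma mat_adjoint_index:
  assumes "A \<in> carrier_mat nr nc" "i < nc" "j < nr"
  shows "mat_adjoint A $$ (i, j) = cnj (A $$ (j, i))"
  using assms unfolding mat_adjoint_def by (simp add: mat_of_rows_index)

text \<open>The initial state is \<open>\<rho>\<close> placed at the advice indices of
  \<open>y\<close> and zero elsewhere. All sums over \<open>2 ^ n\<close> indices therefore collapse
  to the advice register, leaving \<open>Tr (\<rho> M)\<close>.\<close>

lemma accept_prob_eq_expval:
  assumes gs: "\<And>g. g \<in> set gs \<Longrightarrow> wf_gate n g" and y: "length y = lam" and n: "lam + m \<le> n"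
  shows "accept_prob lam m n gs \<rho> y
    = expval (2 ^ m) (\<lambda>i j. \<rho> $$ (i, j)) (accept_op lam m n gs y)"
proof -
  define U where "U = circuit_unitary n gs"
  define \<sigma> where "\<sigma> = init_state lam m n \<rho> y"
  define a where "a = advice_index lam y"
  let ?N = "2 ^ n :: nat" and ?P = "{x. x < 2 ^ n \<and> qbit x 0 = 1}"
  have U: "U \<in> carrier_mat ?N ?N" using circuit_unitary_orthonormal[OF gs] by (simp add: U_def)
  have \<sigma>: "\<sigma> \<in> carrier_mat ?N ?N" by (simp add: \<sigma>_def init_state_def)
  have adj: "mat_adjoint U \<in> carrier_mat ?N ?N"
    using U by (auto simp: mat_adjoint_def)
  have a_less: "a i < ?N" if "i < 2 ^ m" for i
    using advice_index_less[OF y that n] by (simp add: a_def)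
  have inj: "inj_on a {..<2 ^ m}" by (auto simp: inj_on_def a_def advice_index_eq_iff)
  have \<sigma>_index: "\<sigma> $$ (a i, a j) = \<rho> $$ (i, j)" if "i < 2 ^ m" "j < 2 ^ m" for i j
    using that a_less by (simp add: \<sigma>_def init_state_def a_def advice_index_div[OF y])
  have \<sigma>_0: "\<sigma> $$ (z, z') = 0" if "z < ?N" "z' < ?N" "z \<notin> a ` {..<2 ^ m} \<or> z' \<notin> a ` {..<2 ^ m}" for z z'
    using that advice_index_surj[of _ lam y m] by (auto simp: \<sigma>_def init_state_def a_def)
  have entry: "(U * \<sigma> * mat_adjoint U) $$ (x, x)
      = (\<Sum>i<2 ^ m. \<Sum>j<2 ^ m. \<rho> $$ (i, j) * (U $$ (x, a i) * cnj (U $$ (x, a j))))" if x: "x < ?N" for x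
  proof -
    have "(U * \<sigma> * mat_adjoint U) $$ (x, x) = (\<Sum>z'<?N. (U * \<sigma>) $$ (x, z') * cnj (U $$ (x, z')))"
      using x by (subst mat_mult_index[OF mult_carrier_mat[OF U \<sigma>] adj])
        (simp_all add: mat_adjoint_index[OF U])
    also have "\<dots> = (\<Sum>z'<?N. (\<Sum>z<?N. U $$ (x, z) * \<sigma> $$ (z, z')) * cnj (U $$ (x, z')))"
      using x by (intro sum.cong refl) (simp add: mat_mult_index[OF U \<sigma>])
    also have "\<dots> = (\<Sum>z'<?N. \<Sum>z<?N. \<sigma> $$ (z, z') * (U $$ (x, z) * cnj (U $$ (x, z'))))"
      unfolding sum_distrib_right by (intro sum.cong refl) simp
    also have "\<dots> = (\<Sum>z'\<in>a ` {..<2 ^ m}. \<Sum>z<?N. \<sigma> $$ (z, z') * (U $$ (x, z) * cnj (U $$ (x, z'))))"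
      using a_less \<sigma>_0 by (intro sum.mono_neutral_right) (auto intro!: sum.neutral)
    also have "\<dots> = (\<Sum>z'\<in>a ` {..<2 ^ m}. \<Sum>z\<in>a ` {..<2 ^ m}. \<sigma> $$ (z, z') * (U $$ (x, z) * cnj (U $$ (x, z'))))"
      using a_less \<sigma>_0 by (intro sum.cong refl sum.mono_neutral_right) auto
    also have "\<dots> = (\<Sum>j<2 ^ m. \<Sum>i<2 ^ m. \<sigma> $$ (a i, a j) * (U $$ (x, a i) * cnj (U $$ (x, a j))))"
      by (simp add: sum.reindex[OF inj])
    also have "\<dots> = (\<Sum>i<2 ^ m. \<Sum>j<2 ^ m. \<rho> $$ (i, j) * (U $$ (x, a i) * cnj (U $$ (x, a j))))"
      by (subst sum.swap) (simp add: \<sigma>_index)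
    finally show ?thesis .
  qed
  have "mtrace (proj_out1 n * (U * \<sigma> * mat_adjoint U))
      = (\<Sum>x<?N. \<Sum>z<?N. proj_out1 n $$ (x, z) * (U * \<sigma> * mat_adjoint U) $$ (z, x))"
    using U \<sigma> adj unfolding mtrace_def
    by (intro sum.cong) (simp_all add: proj_out1_def scalar_prod_def lessThan_atLeast0)
  also have "\<dots> = (\<Sum>x<?N. \<Sum>z<?N. if x = z then (if qbit x 0 = 1 then (U * \<sigma> * mat_adjoint U) $$ (x, x) else 0) else 0)"
    by (intro sum.cong refl) (auto simp: proj_out1_def)
  also have "\<dots> = (\<Sum>x\<in>?P. (U * \<sigma> * mat_adjoint U) $$ (x, x))"
  proof -
    have "(\<Sum>z<?N. if x = z then (if qbit x 0 = 1 then (U * \<sigma> * mat_adjoint U) $$ (x, x) else 0) else 0)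
        = (if qbit x 0 = 1 then (U * \<sigma> * mat_adjoint U) $$ (x, x) else 0)" if "x < ?N" for x
      using that by simp
    then show ?thesis
      by (intro sum.mono_neutral_cong_right) auto
  qed
  also have "\<dots> = (\<Sum>x\<in>?P. \<Sum>i<2 ^ m. \<Sum>j<2 ^ m. \<rho> $$ (i, j) * (U $$ (x, a i) * cnj (U $$ (x, a j))))"
    by (intro sum.cong refl entry) auto
  also have "\<dots> = (\<Sum>i<2 ^ m. \<Sum>j<2 ^ m. \<Sum>x\<in>?P. \<rho> $$ (i, j) * (U $$ (x, a i) * cnj (U $$ (x, a j))))"
    by (subst sum.swap, rule sum.cong[OF refl], rule sum.swap)
  finally have tr: "mtrace (proj_out1 n * (U * \<sigma> * mat_adjoint U))
      = (\<Sum>i<2 ^ m. \<Sum>j<2 ^ m. \<rho> $$ (i, j) * (\<Sum>x\<in>?P. U $$ (x, a i) * cnj (U $$ (x, a j))))"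
    by (simp only: sum_distrib_left)
  have "accept_prob lam m n gs \<rho> y = Re (mtrace (proj_out1 n * (U * \<sigma> * mat_adjoint U)))"
    by (simp only: accept_prob_def Let_def U_def \<sigma>_def)
  also have "\<dots> = expval (2 ^ m) (\<lambda>i j. \<rho> $$ (i, j)) (compress (2 ^ m) ?P (\<lambda>x i. U $$ (x, a i)))"
    by (simp only: tr expval_compress)
  also have "\<dots> = expval (2 ^ m) (\<lambda>i j. \<rho> $$ (i, j)) (accept_op lam m n gs y)"
    by (simp only: accept_op_def U_def a_def)
  finally show ?thesis .
qed

lemma psd_trace_one_density_mat:
  assumes "density_mat d \<rho>"
  shows "psd_trace_one d (\<lambda>i j. \<rho> $$ (i, j))"
proof -
  have "(\<Sum>i<d. \<rho> $$ (i, i)) = 1"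
    using assms by (auto simp: density_mat_def mtrace_def)
  moreover have "0 \<le> Re (\<Sum>i<d. \<Sum>j<d. cnj (v i) * \<rho> $$ (i, j) * v j)" for v
  proof -
    have "Matrix.vec d v \<in> carrier_vec d" by simp
    with assms have "0 \<le> Re (\<Sum>i<d. \<Sum>j<d. cnj (Matrix.vec d v $ i) * \<rho> $$ (i, j) * Matrix.vec d v $ j)"
      unfolding density_mat_def Let_def by blast
    then show ?thesis by simp
  qed
  ultimately show ?thesis by (simp add: psd_trace_one_def)
qed

section \<open>Counting circuits and choice of parameters\<close>

text \<open>Advice enters only through its number of qubits \<open>m\<close>: states are handled by
  the operator bounds, so the family to be fooled is finite.\<close>

definition small_circuits :: "nat \<Rightarrow> nat \<Rightarrow> (nat \<times> nat \<times> gate list) set" where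
  "small_circuits lam s = {(n, m, gs). n \<le> s \<and> lam + m \<le> n \<and> length gs \<le> s \<and> (\<forall>g\<in>set gs. wf_gate n g)}"

text \<open>At most \<open>s\<close> Hadamard gates, \<open>s\<close> T gates and \<open>s^2\<close>
  CNOTs. The extra 1 matches the base that \<open>sum_powers_le\<close> produces when lists of
  length at most \<open>s\<close> are counted.\<close>

lemma wf_gates_bound:
  "finite {g. wf_gate s g}" "card {g. wf_gate s g} + 1 \<le> (s + 1)\<^sup>2"
proof -
  let ?G = "Had ` {..<s} \<union> Tgate ` {..<s} \<union> (\<lambda>(c, t). CNOT c t) ` ({..<s} \<times> {..<s})"
  have sub: "{g. wf_gate s g} \<subseteq> ?G"
  proof
    fix g assume "g \<in> {g. wf_gate s g}"
    then show "g \<in> ?G" by (cases g) (auto simp: wf_gate_def)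
  qed
  then show "finite {g. wf_gate s g}"
    by (rule finite_subset) auto
  have "card {g. wf_gate s g} \<le> card ?G"
    by (rule card_mono[OF _ sub]) auto
  also have "\<dots> \<le> card (Had ` {..<s} \<union> Tgate ` {..<s}) + card ((\<lambda>(c, t). CNOT c t) ` ({..<s} \<times> {..<s}))"
    by (rule card_Un_le)
  also have "\<dots> \<le> card (Had ` {..<s}) + card (Tgate ` {..<s}) + card ((\<lambda>(c, t). CNOT c t) ` ({..<s} \<times> {..<s}))"
    by (rule add_right_mono) (rule card_Un_le)
  also have "\<dots> \<le> card {..<s} + card {..<s} + card ({..<s} \<times> {..<s})"
    by (intro add_mono card_image_le) auto
  finally show "card {g. wf_gate s g} + 1 \<le> (s + 1)\<^sup>2"
    by (simp add: power2_eq_square)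
qed

lemma sum_powers_le: "(\<Sum>i\<le>s. a ^ i) \<le> (a + 1) ^ s" for a :: nat
proof (induction s)
  case (Suc s)
  have "a * a ^ s \<le> a * (a + 1) ^ s" by (intro mult_left_mono power_mono) auto
  moreover have "(a + 1) ^ Suc s = (a + 1) ^ s + a * (a + 1) ^ s" by simp
  moreover have "(\<Sum>i\<le>Suc s. a ^ i) = (\<Sum>i\<le>s. a ^ i) + a * a ^ s" by simp
  ultimately show ?case using Suc by linarith
qed simp

lemma small_circuits_bound:
  assumes s: "s > 0"
  shows "finite (small_circuits lam s)"
    and "(\<Sum>(n, m, gs)\<in>small_circuits lam s. 2 ^ m) \<le> (2::nat) ^ (8 * s\<^sup>2)"
proof -
  let ?G = "{g. wf_gate s g}"
  let ?L = "{gs. set gs \<subseteq> ?G \<and> length gs \<le> s}"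
  \<comment> \<open>A gate on \<open>n\<close> wires is also well-formed on \<open>s\<close> wires
    when \<open>n \<le> s\<close>, so one gate set serves all circuits.\<close>
  have sub: "small_circuits lam s \<subseteq> {..s} \<times> {..s} \<times> ?L"
    by (auto simp: small_circuits_def wf_gate_def split: gate.splits; fastforce)
  have finL: "finite ({..s} \<times> {..s} \<times> ?L)"
    using finite_lists_length_le[OF wf_gates_bound(1)] by auto
  with sub show "finite (small_circuits lam s)" by (rule finite_subset)
  have "card ?L \<le> (card ?G + 1) ^ s"
    unfolding card_lists_length_le[OF wf_gates_bound(1)] by (rule sum_powers_le)
  also have "\<dots> \<le> ((s + 1)\<^sup>2) ^ s"
    by (intro power_mono wf_gates_bound(2)) simp
  finally have cL: "card ?L \<le> ((s + 1)\<^sup>2) ^ s" .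
  have "card (small_circuits lam s) \<le> card ({..s} \<times> {..s} \<times> ?L)"
    by (rule card_mono[OF finL sub])
  also have "\<dots> = (s + 1) * ((s + 1) * card ?L)"
    by (simp add: card_cartesian_product)
  also have "\<dots> \<le> (s + 1) * ((s + 1) * ((s + 1)\<^sup>2) ^ s)"
    by (intro mult_le_mono cL order_refl)
  finally have cC: "card (small_circuits lam s) \<le> (s + 1) * ((s + 1) * ((s + 1)\<^sup>2) ^ s)" .
  have "(\<Sum>(n, m, gs)\<in>small_circuits lam s. 2 ^ m) \<le> (\<Sum>c\<in>small_circuits lam s. (2::nat) ^ s)"
    by (intro sum_mono) (auto simp: small_circuits_def intro!: power_increasing)
  also have "\<dots> = card (small_circuits lam s) * 2 ^ s" by simp
  also have "\<dots> \<le> (s + 1) * ((s + 1) * ((s + 1)\<^sup>2) ^ s) * 2 ^ s"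
    by (rule mult_le_mono1[OF cC])
  also have "\<dots> = (s + 1) ^ (2 * s + 2) * 2 ^ s"
    unfolding power_add power_mult by (simp only: power2_eq_square mult_ac)
  \<comment> \<open>Uses \<open>s + 1 \<le> 2 ^ s\<close>.\<close>
  also have "\<dots> \<le> (2 ^ s) ^ (2 * s + 2) * 2 ^ s"
    using Suc_leI[OF less_exp[of s]] by (intro mult_right_mono power_mono) auto
  also have "\<dots> = 2 ^ (s * (2 * s + 2) + s)"
    by (simp only: power_add power_mult)
  also have "\<dots> \<le> (2::nat) ^ (8 * s\<^sup>2)"
  proof (rule power_increasing)
    \<comment> \<open>The exponent is \<open>2 s^2 + 3 s\<close>, at most \<open>5 s^2\<close>. The
      coefficient is rounded up to 8 so that it is a power of two, as \<open>p\<close> must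
      be.\<close>
    have "s \<le> s * s" using s by simp
    then show "s * (2 * s + 2) + s \<le> 8 * s\<^sup>2"
      by (simp add: power2_eq_square algebra_simps)
  qed simp
  finally show "(\<Sum>(n, m, gs)\<in>small_circuits lam s. 2 ^ m) \<le> (2::nat) ^ (8 * s\<^sup>2)" .
qed

lemma abs_le_if_even_power_le:
  fixes x :: real
  assumes p: "p > 0" and le: "x ^ (2 * p) \<le> 2 ^ p * (4 * real p ^ 2 / real p ^ 4) ^ p"
  shows "\<bar>x\<bar> \<le> 3 / p"
proof -
  have "2 * (4 * real p ^ 2 / real p ^ 4) = 8 / (real p)\<^sup>2"
    using p by (simp add: field_simps flip: power_add)
  with le have "(x\<^sup>2) ^ p \<le> (8 / (real p)\<^sup>2) ^ p"
    by (simp only: power_mult power_mult_distrib[symmetric])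
  \<comment> \<open>Taking \<open>p\<close>-th roots removes the circuit count \<open>2 ^ p\<close>
    at the price of a constant factor 2; the final 3 rounds up the square root of 8.\<close>
  then have "x\<^sup>2 \<le> 8 / (real p)\<^sup>2"
    by (rule iffD1[OF power_mono_iff, rotated 3]) (use p in auto)
  also have "\<dots> \<le> (3 / p)\<^sup>2"
    using p by (simp add: power_divide divide_right_mono)
  finally have "\<bar>x\<bar> \<le> \<bar>3 / p\<bar>" by (simp only: abs_le_square_iff)
  then show ?thesis by simp
qed

lemma eight_times_square_power2: "8 * (2 ^ t)\<^sup>2 = (2::nat) ^ (2 * t + 3)"
proof -
  have "((2::nat) ^ t)\<^sup>2 = 2 ^ (2 * t)" by (simp only: power_mult[symmetric] mult.commute)
  then show ?thesis by (simp add: power_add)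
qed

lemma exists_sparse_fooling_pmf:
  fixes t :: nat
  defines "s \<equiv> 2 ^ t"
  defines "p \<equiv> 8 * s\<^sup>2"
  shows "\<exists>D. set_pmf D \<subseteq> {y. length y = lam} \<and> card (set_pmf D) \<le> p ^ 4 \<and>
    (\<forall>n m gs \<rho>. (n, m, gs) \<in> small_circuits lam s \<longrightarrow> density_mat (2 ^ m) \<rho> \<longrightarrow>
       \<bar>measure_pmf.expectation D (accept_prob lam m n gs \<rho>)
         - measure_pmf.expectation (uniform_bits lam) (accept_prob lam m n gs \<rho>)\<bar> \<le> 3 / p)"
proof -
  define S where "S = {..<p ^ 4}"
  define Y where "Y = {y :: bool list. length y = lam}"
  define I where "I = small_circuits lam s"
  define d where "d = (\<lambda>(n :: nat, m :: nat, gs :: gate list). (2 :: nat) ^ m)"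
  define A where "A = (\<lambda>(n, m, gs). accept_op lam m n gs)"
  have s: "s > 0" by (simp add: s_def)
  then have p: "p > 0" by (simp add: p_def)
  have pr: "p = 2 ^ (2 * t + 3)"
    unfolding p_def s_def by (rule eight_times_square_power2)
  have S: "finite S" "S \<noteq> {}" "card S = p ^ 4" using p by (auto simp: S_def lessThan_empty_iff)
  have "Y = {y. set y \<subseteq> UNIV \<and> length y = lam}" by (simp add: Y_def)
  then have Y: "finite Y" "Y \<noteq> {}"
    using finite_lists_length_eq[of "UNIV :: bool set" lam]
    by (auto simp: Y_def intro: exI[of _ "replicate lam True"])
  have "\<exists>f\<in>Pi\<^sub>E S (\<lambda>_. Y). \<forall>l\<in>I. \<forall>\<rho>. psd_trace_one (d l) \<rho> \<longrightarrow>
      ((\<Sum>k\<in>S. expval (d l) \<rho> (A l (f k))) / card S - (\<Sum>y\<in>Y. expval (d l) \<rho> (A l y)) / card Y) ^ (2 * p)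
           \<le> real (\<Sum>l\<in>I. d l) * (4 * real p ^ 2 / card S) ^ p"
  proof (rule exists_sample_expval_close[OF S(1) Y(1) _ S(2) Y(2) pr])
    show "finite I" using small_circuits_bound(1)[OF s] by (simp add: I_def)
    show "op_bound (d l) 1 (A l y)" if "l \<in> I" "y \<in> Y" for l y
      using that by (auto simp: I_def Y_def A_def d_def small_circuits_def intro!: op_bound_accept_op)
    show "Modules.additive (A l y)" "self_adjoint (d l) (A l y)" for l y
      by (auto simp: A_def d_def accept_op_def additive_compress self_adjoint_compress split: prod.splits)
  qed
  then obtain f where f: "f \<in> Pi\<^sub>E S (\<lambda>_. Y)" and
    close: "\<And>l \<rho>. l \<in> I \<Longrightarrow> psd_trace_one (d l) \<rho> \<Longrightarrow>
      ((\<Sum>k\<in>S. expval (d l) \<rho> (A l (f k))) / card S - (\<Sum>y\<in>Y. expval (d l) \<rho> (A l y)) / card Y) ^ (2 * p)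
           \<le> real (\<Sum>l\<in>I. d l) * (4 * real p ^ 2 / card S) ^ p"
    by blast
  \<comment> \<open>Pushing forward the uniform distribution on the sample indices keeps repeated
    strings with their multiplicity, so expectations under \<open>D\<close> are exactly the sample
    averages.\<close>
  define D where "D = map_pmf f (pmf_of_set S)"
  have supp: "set_pmf D = f ` S" using S by (simp add: D_def)
  show ?thesis
  proof (intro exI[of _ D] conjI allI impI)
    show "set_pmf D \<subseteq> {y. length y = lam}" using f by (auto simp: supp Y_def)
    show "card (set_pmf D) \<le> p ^ 4" unfolding supp S(3)[symmetric] by (rule card_image_le) (rule S)
    fix n m gs \<rho> assume c: "(n, m, gs) \<in> small_circuits lam s" and \<rho>: "density_mat (2 ^ m) \<rho>"
    let ?g = "accept_prob lam m n gs \<rho>" and ?e = "expval (2 ^ m) (\<lambda>i j. \<rho> $$ (i, j))"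
    have g: "?g y = ?e (A (n, m, gs) y)" if "y \<in> Y" for y
      using accept_prob_eq_expval[of gs n y lam m \<rho>] c that by (auto simp: small_circuits_def Y_def A_def)
    have "measure_pmf.expectation D ?g = (\<Sum>k\<in>S. ?g (f k)) / card S"
      using S by (simp add: D_def integral_pmf_of_set)
    also have "(\<Sum>k\<in>S. ?g (f k)) = (\<Sum>k\<in>S. ?e (A (n, m, gs) (f k)))"
      using f by (intro sum.cong refl g) auto
    finally have ED: "measure_pmf.expectation D ?g = (\<Sum>k\<in>S. ?e (A (n, m, gs) (f k))) / card S" .
    have "measure_pmf.expectation (uniform_bits lam) ?g = (\<Sum>y\<in>Y. ?g y) / card Y"
      using Y by (simp add: uniform_bits_def Y_def[symmetric] integral_pmf_of_set)
    also have "(\<Sum>y\<in>Y. ?g y) = (\<Sum>y\<in>Y. ?e (A (n, m, gs) y))"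
      by (intro sum.cong refl g)
    finally have EU: "measure_pmf.expectation (uniform_bits lam) ?g = (\<Sum>y\<in>Y. ?e (A (n, m, gs) y)) / card Y" .
    have "(measure_pmf.expectation D ?g - measure_pmf.expectation (uniform_bits lam) ?g) ^ (2 * p)
        \<le> real (\<Sum>l\<in>I. d l) * (4 * real p ^ 2 / card S) ^ p"
      using close[of "(n, m, gs)"] c psd_trace_one_density_mat[OF \<rho>] unfolding ED EU
      by (simp add: I_def d_def)
    \<comment> \<open>The total advice dimension of all small circuits is at most
      \<open>2 ^ p\<close>, which is why \<open>p\<close> is tied to
      \<open>8 * s\<^sup>2\<close>.\<close>
    also have "\<dots> \<le> real (2 ^ p) * (4 * real p ^ 2 / card S) ^ p"
      using small_circuits_bound(2)[OF s, of lam]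
      by (intro mult_right_mono of_nat_mono) (simp_all add: I_def d_def p_def)
    also have "\<dots> = 2 ^ p * (4 * real p ^ 2 / real p ^ 4) ^ p"
      by (simp add: S)
    finally show "\<bar>measure_pmf.expectation D ?g - measure_pmf.expectation (uniform_bits lam) ?g\<bar> \<le> 3 / p"
      using p by (rule abs_le_if_even_power_le[rotated])
  qed
qed

section \<open>Asymptotics and the final assembly\<close>

lemma eventually_poly_less_exp:
  "\<exists>N. \<forall>n\<ge>N. c * n ^ k + c < (2::nat) ^ (n div 32)"
proof -
  \<comment> \<open>The 1 subtracted in the exponent absorbs the rounding in
    \<open>n div 32\<close>.\<close>
  have "\<forall>\<^sub>F n in sequentially. real c * real n ^ k + real c < 2 powr (real n / 32 - 1)"
    by real_asymp
  then obtain N where N: "\<And>n. n \<ge> N \<Longrightarrow> real c * real n ^ k + real c < 2 powr (real n / 32 - 1)"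
    by (auto simp: eventually_sequentially)
  have "c * n ^ k + c < 2 ^ (n div 32)" if "n \<ge> N" for n
  proof -
    have "real (c * n ^ k + c) < 2 powr (real n / 32 - 1)" using N[OF that] by simp
    also have "\<dots> \<le> 2 powr real (n div 32)"
      by (intro powr_mono) linarith+
    also have "\<dots> = real (2 ^ (n div 32))" by (simp add: powr_realpow)
    finally show ?thesis by (simp only: of_nat_less_iff)
  qed
  then show ?thesis by blast
qed

lemma negligible_if_le_inverse_exp:
  assumes "\<And>n. n \<ge> N \<Longrightarrow> \<bar>f n\<bar> \<le> 1 / 2 ^ (n div 32)"
  shows "negligible f"
  unfolding negligible_def
proof
  fix c
  obtain M where M: "\<And>n. n \<ge> M \<Longrightarrow> 1 * n ^ c + 1 < (2::nat) ^ (n div 32)"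
    using eventually_poly_less_exp by blast
  \<comment> \<open>Taking \<open>n \<ge> 1\<close> keeps \<open>n ^ c\<close> positive, as the
    comparison of reciprocals requires.\<close>
  have "\<bar>f n\<bar> < 1 / real n ^ c" if n: "n \<ge> max 1 (max M N)" for n
  proof -
    have "n ^ c < (2::nat) ^ (n div 32)" using M[of n] n by simp
    then have "real n ^ c < 2 ^ (n div 32)"
      using of_nat_less_iff[where 'a = real, of "n ^ c" "2 ^ (n div 32)"] by simp
    then have "1 / 2 ^ (n div 32) < 1 / real n ^ c" using n by (intro divide_strict_left_mono) auto
    with assms[of n] n show ?thesis by simp
  qed
  then show "\<exists>N. \<forall>n\<ge>N. \<bar>f n\<bar> < 1 / real n ^ c" by blast
qed

theorem theorem3p2:
  shows "\<exists>D :: nat \<Rightarrow> bool list pmf.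
    (\<forall>lam. set_pmf (D lam) \<subseteq> {y. length y = lam})
    \<and> negligible (\<lambda>lam. real (card (set_pmf (D lam))) / 2 ^ lam)
    \<and> (\<forall>nwires madv gs \<rho>. nonuniform_qpt nwires madv gs \<rho> \<longrightarrow>
         negligible (\<lambda>lam.
           \<bar>measure_pmf.expectation (D lam)
               (accept_prob lam (madv lam) (nwires lam) (gs lam) (\<rho> lam))
            - measure_pmf.expectation (uniform_bits lam)
               (accept_prob lam (madv lam) (nwires lam) (gs lam) (\<rho> lam))\<bar>))"
proof -
  \<comment> \<open>This size outgrows every polynomial, yet the rate 1/32 leaves room for
    sparseness: with \<open>t = lam div 32\<close>, the support bound times \<open>s\<close> is
    \<open>2 ^ (9 * t + 12)\<close>, while \<open>32 * t \<le> lam\<close>.\<close>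
  define s :: "nat \<Rightarrow> nat" where "s lam = 2 ^ (lam div 32)" for lam
  define p where "p lam = 8 * (s lam)\<^sup>2" for lam
  define good where "good lam D \<longleftrightarrow> set_pmf D \<subseteq> {y. length y = lam} \<and> card (set_pmf D) \<le> p lam ^ 4 \<and>
    (\<forall>n m gs \<rho>. (n, m, gs) \<in> small_circuits lam (s lam) \<longrightarrow> density_mat (2 ^ m) \<rho> \<longrightarrow>
       \<bar>measure_pmf.expectation D (accept_prob lam m n gs \<rho>)
         - measure_pmf.expectation (uniform_bits lam) (accept_prob lam m n gs \<rho>)\<bar> \<le> 3 / p lam)" for lam D
  have "\<exists>D. good lam D" for lam
    unfolding good_def p_def s_def by (rule exists_sparse_fooling_pmf)
  then obtain D where D: "\<And>lam. good lam (D lam)" by metis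
  have supp: "set_pmf (D lam) \<subseteq> {y. length y = lam}" and card: "card (set_pmf (D lam)) \<le> p lam ^ 4" for lam
    using D[of lam] by (simp_all only: good_def)
  have fool: "\<bar>measure_pmf.expectation (D lam) (accept_prob lam m n gs \<rho>)
         - measure_pmf.expectation (uniform_bits lam) (accept_prob lam m n gs \<rho>)\<bar> \<le> 3 / p lam"
    if "(n, m, gs) \<in> small_circuits lam (s lam)" "density_mat (2 ^ m) \<rho>" for lam n m gs \<rho>
    using D[of lam] that unfolding good_def by blast
  show ?thesis
  proof (intro exI[of _ D] conjI allI impI)
    show "set_pmf (D lam) \<subseteq> {y. length y = lam}" for lam by (rule supp)
    show "negligible (\<lambda>lam. real (card (set_pmf (D lam))) / 2 ^ lam)"
    proof (rule negligible_if_le_inverse_exp)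
      \<comment> \<open>From 32 on, \<open>?t\<close> is at least 1, which absorbs the additive
        constant 12 in the exponent.\<close>
      fix lam :: nat assume lam: "lam \<ge> 32"
      let ?t = "lam div 32"
      have "p lam = 2 ^ (2 * ?t + 3)"
        unfolding p_def s_def by (rule eight_times_square_power2)
      then have "p lam ^ 4 * s lam = 2 ^ ((2 * ?t + 3) * 4 + ?t)"
        by (simp only: s_def power_mult power_add)
      also have "\<dots> \<le> 2 ^ lam"
      proof (rule power_increasing)
        have "(2 * t + 3) * 4 + t \<le> lam" if "1 \<le> t" "32 * t \<le> lam" for t :: nat
          using that by presburger
        moreover have "1 \<le> ?t" using div_le_mono[OF lam, of 32] by simp
        moreover have "32 * ?t \<le> lam" by simp
        ultimately show "(2 * ?t + 3) * 4 + ?t \<le> lam" by blast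
      qed simp
      finally have "card (set_pmf (D lam)) * s lam \<le> 2 ^ lam"
        by (rule order_trans[OF mult_le_mono1[OF card]])
      then have "real (card (set_pmf (D lam))) * 2 ^ ?t \<le> 2 ^ lam"
        using of_nat_le_iff[where 'a = real, of "card (set_pmf (D lam)) * s lam" "2 ^ lam"]
        by (simp add: s_def)
      then have "real (card (set_pmf (D lam))) \<le> 2 ^ lam / 2 ^ ?t"
        by (intro mult_imp_le_div_pos) simp_all
      then have "real (card (set_pmf (D lam))) / 2 ^ lam \<le> 1 / 2 ^ ?t"
        by (intro mult_imp_div_pos_le) simp_all
      then show "\<bar>real (card (set_pmf (D lam))) / 2 ^ lam\<bar> \<le> 1 / 2 ^ ?t"
        by simp
    qed
    fix nwires madv gs \<rho> assume "nonuniform_qpt nwires madv gs \<rho>"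
    then obtain c where qpt: "\<And>lam. lam + madv lam \<le> nwires lam"
      "\<And>lam g. g \<in> set (gs lam) \<Longrightarrow> wf_gate (nwires lam) g"
      "\<And>lam. density_mat (2 ^ madv lam) (\<rho> lam)"
      "\<And>lam. nwires lam + length (gs lam) \<le> c * lam ^ c + c"
      unfolding nonuniform_qpt_def by blast
    obtain N where N: "\<And>n. n \<ge> N \<Longrightarrow> c * n ^ c + c < (2::nat) ^ (n div 32)"
      using eventually_poly_less_exp by blast
    show "negligible (\<lambda>lam. \<bar>measure_pmf.expectation (D lam)
               (accept_prob lam (madv lam) (nwires lam) (gs lam) (\<rho> lam))
            - measure_pmf.expectation (uniform_bits lam)
               (accept_prob lam (madv lam) (nwires lam) (gs lam) (\<rho> lam))\<bar>)"
    proof (rule negligible_if_le_inverse_exp)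
      \<comment> \<open>Beyond \<open>N\<close> the polynomial size bound of the distinguisher lies
        below \<open>s lam\<close>, so its circuit is among those that \<open>D lam\<close> fools,
        with whatever advice state it carries.\<close>
      fix lam assume "lam \<ge> N"
      with N[of lam] qpt(4)[of lam] have "nwires lam + length (gs lam) \<le> s lam"
        by (simp add: s_def)
      then have "(nwires lam, madv lam, gs lam) \<in> small_circuits lam (s lam)"
        using qpt(1,2) by (auto simp: small_circuits_def)
      note fool[OF this qpt(3)]
      also have "3 / real (p lam) \<le> 1 / 2 ^ (lam div 32)"
      proof -
        have "1 \<le> s lam" by (simp add: s_def)
        then have "3 * s lam \<le> p lam"
          using mult_le_mono1[of 1 "s lam" "s lam"] unfolding p_def power2_eq_square by linarith
        then have "3 * real (s lam) \<le> real (p lam)" by linarith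
        with \<open>1 \<le> s lam\<close> have "3 / real (p lam) \<le> 1 / real (s lam)"
          by (intro iffD2[OF frac_le_eq]) (auto intro!: divide_nonpos_pos mult_pos_pos)
        then show ?thesis by (simp add: s_def)
      qed
      finally show "\<bar>\<bar>measure_pmf.expectation (D lam)
               (accept_prob lam (madv lam) (nwires lam) (gs lam) (\<rho> lam))
            - measure_pmf.expectation (uniform_bits lam)
               (accept_prob lam (madv lam) (nwires lam) (gs lam) (\<rho> lam))\<bar>\<bar> \<le> 1 / 2 ^ (lam div 32)"
        by simp
    qed
  qed
qed

end
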